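(* For every $\kappa>0$ there is a constant $C>0$ depending only on $\kappa$ such that the following holds. Let $\mu$ be a Borel probability measure on $\mathbb{R}^n\times\{-1,+1\}$ and let $\mathcal{X}\subseteq\mathbb{R}^n$ be the support of its marginal on $\mathbb{R}^n$. Assume that: (i) $\mu$ is linearly separable by the hyperplane in $\mathbb{R}^n$ indexed by $(w_0,b_0)\in\mathbb{R}^n\times\mathbb{R}$, i.e. $\mathbb{P}_{(\mathsf{x},\mathsf{y})\sim\mu}[\mathsf{y}(\langle w_0,\mathsf{x}\rangle+b_0)\ge 1]=1$; and (ii) $\|x\|\le R$ and $\|x\|_0\le s$ for all $x\in\mathcal{X}$. Let $Q\in\mathbb{R}^{m\times n}$ be a random matrix with independent, isotropic, sub-Gaussian rows, all with the same sub-Gaussian norm $\kappa$, and let $\varepsilon\in(0,1)$. If $$m> C R^4\|w_0\|^4\left(2s\ln\frac{en}{2s}+\ln(2\varepsilon^{-1})\right),$$ then, with probability at least $1-\varepsilon$ over $Q$, $\mu$ remains linearly separable under the compression of $\frac{1}{\sqrt m}Q$, i.e. there exists $(w',b')\in\mathbb{R}^m\times\mathbb{R}$ such that $\mathbb{P}_{(\mathsf{x},\mathsf{y})\sim\mu}\left[\mathsf{y}\left(\left\langle w',\tfrac{1}{\sqrt m}Q\mathsf{x}\right\rangle+b'\right)\ge 1\right]=1$.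
   Context: $\|\cdot\|$ is the Euclidean norm and $\|x\|_0$ is the number of nonzero coordinates of $x$; $s$ is an integer with $1\le s\le n$. The support is described as follows: $\mathcal{X}^+$ is the set of $x\in\mathbb{R}^n$ such that $\mu(\mathcal{A}\times\{+1\})>0$ for every open $\mathcal{A}\subseteq\mathbb{R}^n$ containing $x$; $\mathcal{X}^-$ is defined in the same way with $-1$ in place of $+1$; and $\mathcal{X}=\mathcal{X}^+\cup\mathcal{X}^-$. A random vector $q\in\mathbb{R}^n$ is isotropic if $\mathbb{E}[qq^{T}]=I_n$; its sub-Gaussian norm is $\sup_{\|u\|=1}\|\langle q,u\rangle\|_{\psi_2}$, where $\|Z\|_{\psi_2}=\inf\{t>0:\mathbb{E}\exp(Z^2/t^2)\le 2\}$, and $q$ is sub-Gaussian if this is finite. *)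

theory Defs
  imports "HOL-Probability.Probability"
begin

text \<open>
  The constant of the theorem must not depend on the dimensions, so these have to be bound inside
  the statement and cannot be types. A vector of \<open>\<real>\<^sup>n\<close> is therefore a function
  \<open>x \<in> {..<n} \<rightarrow>\<^sub>E UNIV\<close>, i.e. \<open>x i = undefined\<close> for \<open>i \<ge> n\<close>. As the index set is finite, the
  product \<open>\<sigma>\<close>-algebra is the Borel \<open>\<sigma>\<close>-algebra of the product topology.
\<close>

abbreviation Rn :: "nat \<Rightarrow> (nat \<Rightarrow> real) measure" where
  "Rn n \<equiv> Pi\<^sub>M {..<n} (\<lambda>_. borel)"

abbreviation Rn_top :: "nat \<Rightarrow> (nat \<Rightarrow> real) topology" where
  "Rn_top n \<equiv> product_topology (\<lambda>_. euclidean) {..<n}"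

definition inner_n :: "nat \<Rightarrow> (nat \<Rightarrow> real) \<Rightarrow> (nat \<Rightarrow> real) \<Rightarrow> real" where
  "inner_n n u v = (\<Sum>i<n. u i * v i)"

abbreviation norm_n :: "nat \<Rightarrow> (nat \<Rightarrow> real) \<Rightarrow> real" where
  "norm_n n x \<equiv> L2_set x {..<n}"

definition norm0 :: "nat \<Rightarrow> (nat \<Rightarrow> real) \<Rightarrow> nat" where
  "norm0 n x = card {i. i < n \<and> x i \<noteq> 0}"

text \<open>Matrices are families of rows: \<open>A i j\<close> is the entry in row \<open>i < m\<close> and column \<open>j < n\<close>.\<close>

definition mat_vec :: "nat \<Rightarrow> nat \<Rightarrow> (nat \<Rightarrow> nat \<Rightarrow> real) \<Rightarrow> (nat \<Rightarrow> real) \<Rightarrow> (nat \<Rightarrow> real)" where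
  "mat_vec m n A x = (\<lambda>i\<in>{..<m}. inner_n n (A i) x)"

abbreviation Rn_labelled :: "nat \<Rightarrow> ((nat \<Rightarrow> real) \<times> real) measure" where
  "Rn_labelled n \<equiv> Rn n \<Otimes>\<^sub>M count_space {-1, 1}"

definition label_support ::
    "nat \<Rightarrow> ((nat \<Rightarrow> real) \<times> real) measure \<Rightarrow> real \<Rightarrow> (nat \<Rightarrow> real) set" where
  "label_support n \<mu> l =
     {x \<in> space (Rn n). \<forall>A. openin (Rn_top n) A \<and> x \<in> A \<longrightarrow> measure \<mu> (A \<times> {l}) > 0}"

definition data_support :: "nat \<Rightarrow> ((nat \<Rightarrow> real) \<times> real) measure \<Rightarrow> (nat \<Rightarrow> real) set" where
  "data_support n \<mu> = label_support n \<mu> 1 \<union> label_support n \<mu> (-1)"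

definition separable_by ::
    "nat \<Rightarrow> ((nat \<Rightarrow> real) \<times> real) measure \<Rightarrow> (nat \<Rightarrow> real) \<Rightarrow> real \<Rightarrow> bool" where
  "separable_by n \<mu> w b \<longleftrightarrow>
     measure \<mu> {(x, y) \<in> space \<mu>. y * (inner_n n w x + b) \<ge> 1} = 1"

definition separable_under ::
    "nat \<Rightarrow> nat \<Rightarrow> ((nat \<Rightarrow> real) \<times> real) measure \<Rightarrow> (nat \<Rightarrow> nat \<Rightarrow> real) \<Rightarrow> bool" where
  "separable_under m n \<mu> A \<longleftrightarrow>
     (\<exists>w\<in>space (Rn m). \<exists>b.
        measure \<mu> {(x, y) \<in> space \<mu>. y * (inner_n m w (mat_vec m n A x) + b) \<ge> 1} = 1)"

text \<open>
  The expectation is a nonnegative Lebesgue integral, since the Bochner integral would be \<open>0\<close> for a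
  non-integrable function. The norm is \<open>\<infinity>\<close> if no \<open>t\<close> is admissible.
\<close>

definition psi2_norm :: "'a measure \<Rightarrow> ('a \<Rightarrow> real) \<Rightarrow> ennreal" where
  "psi2_norm M Z = Inf (ennreal ` {t. t > 0 \<and> (\<integral>\<^sup>+ \<omega>. ennreal (exp ((Z \<omega>)\<^sup>2 / t\<^sup>2)) \<partial>M) \<le> 2})"

definition subgaussian_norm :: "nat \<Rightarrow> 'a measure \<Rightarrow> ('a \<Rightarrow> nat \<Rightarrow> real) \<Rightarrow> ennreal" where
  "subgaussian_norm n M q =
     (SUP u\<in>{u \<in> space (Rn n). norm_n n u = 1}. psi2_norm M (\<lambda>\<omega>. inner_n n (q \<omega>) u))"

definition subgaussian :: "nat \<Rightarrow> 'a measure \<Rightarrow> ('a \<Rightarrow> nat \<Rightarrow> real) \<Rightarrow> bool" where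
  "subgaussian n M q \<longleftrightarrow> subgaussian_norm n M q < \<infinity>"

definition isotropic :: "nat \<Rightarrow> 'a measure \<Rightarrow> ('a \<Rightarrow> nat \<Rightarrow> real) \<Rightarrow> bool" where
  "isotropic n M q \<longleftrightarrow>
     (\<forall>j<n. \<forall>k<n. has_bochner_integral M (\<lambda>\<omega>. q \<omega> j * q \<omega> k) (if j = k then 1 else 0))"

text \<open>
  A random matrix is given by its law \<open>M\<close> on \<open>\<real>\<^bsup>m\<times>n\<^esup>\<close>, its rows being the coordinate maps: all
  properties in question depend on the law only, and a sample space of arbitrary type could not be
  bound inside the scope of a constant that is independent of it.
\<close>

definition subgaussian_matrix_law :: "nat \<Rightarrow> nat \<Rightarrow> real \<Rightarrow> (nat \<Rightarrow> nat \<Rightarrow> real) measure \<Rightarrow> bool" where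
  "subgaussian_matrix_law m n \<kappa> M \<longleftrightarrow>
     prob_space M \<and>
     sets M = sets (Pi\<^sub>M {..<m} (\<lambda>_. Rn n)) \<and>
     prob_space.indep_vars M (\<lambda>_. Rn n) (\<lambda>i Q. Q i) {..<m} \<and>
     (\<forall>i<m. isotropic n M (\<lambda>Q. Q i) \<and>
            subgaussian n M (\<lambda>Q. Q i) \<and>
            subgaussian_norm n M (\<lambda>Q. Q i) = ennreal \<kappa>)"

end

theory Submission imports Defs begin

text \<open>
  Put \<open>A = Q / sqrt m\<close> and \<open>B x y = \<langle>A x, A y\<rangle> - \<langle>x, y\<rangle>\<close>. By Chernoff bounds and a union bound over a
  grid, with high probability \<open>B\<close> is small on \<open>2 s\<close>-sparse vectors, hence by polarization
  \<open>\<bar>B x x'\<bar> \<le> L * R\<^sup>2\<close> for any two data points. The vector \<open>w0\<close> itself is not sparse, so \<open>A w0\<close> need not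
  separate; but a vector \<open>w\<close> of nearly minimal norm in the convex hull of the differences \<open>d\<close> of
  positive and negative data points does. Indeed \<open>\<bar>B w d\<bar> \<le> 4 * L * R\<^sup>2\<close> by bilinearity, while
  \<open>\<langle>w, d\<rangle>\<close> is almost \<open>\<parallel>w\<parallel>\<^sup>2 \<ge> 4 / \<parallel>w0\<parallel>\<^sup>2\<close>, so \<open>\<langle>A w, A d\<rangle> \<ge> 1 / \<parallel>w0\<parallel>\<^sup>2\<close> once
  \<open>4 * L * (R * \<parallel>w0\<parallel>)\<^sup>2 \<le> 1\<close>.
\<close>

section \<open>The Gram defect and restricted isometries\<close>

text \<open>With r = R |w0|, separation tolerates a defect of order 1 / r^2, and the Chernoff
  exponent is quadratic in the defect; this is where R^4 |w0|^4 comes from. The sparsity order is 2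
  s because two data points have a joint support of at most 2 s indices. Two obstacles lie outside
  the geometry. Separability holds almost surely, whereas the bounds on norm and sparsity hold on
  the support; a countable base of the topology passes between the two. Moreover,
  \<open>measure\<close> is 0 on sets that are not measurable, so a lower bound for the probability
  of separability requires that event to be measurable, although it is an existential statement over
  uncountably many hyperplanes.\<close>

lemma inner_n_lincomb:
  "inner_n n (\<lambda>i. a * x i + b * y i) z = a * inner_n n x z + b * inner_n n y z"
  unfolding inner_n_def by (simp add: sum.distrib sum_distrib_left algebra_simps)

lemma inner_n_commute: "inner_n n x y = inner_n n y x"
  unfolding inner_n_def by (simp add: mult.commute)

lemma inner_n_lincomb_right:
  "inner_n n z (\<lambda>i. a * x i + b * y i) = a * inner_n n z x + b * inner_n n z y"
  using inner_n_lincomb[of n a x b y z] by (simp add: inner_n_commute)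

lemma inner_n_nonneg: "0 \<le> inner_n n x x"
  unfolding inner_n_def by (simp add: sum_nonneg)

lemma norm_n_sq: "(norm_n n x)\<^sup>2 = inner_n n x x"
  unfolding inner_n_def L2_set_def by (simp add: sum_nonneg power2_eq_square)

lemma inner_n_le_norm: "\<bar>inner_n n x y\<bar> \<le> norm_n n x * norm_n n y"
proof -
  have "\<bar>inner_n n x y\<bar> \<le> (\<Sum>i<n. \<bar>x i\<bar> * \<bar>y i\<bar>)"
    unfolding inner_n_def abs_mult[symmetric] by (rule sum_abs)
  also have "\<dots> \<le> norm_n n x * norm_n n y"
    by (rule L2_set_mult_ineq)
  finally show ?thesis .
qed

lemma inner_n_cong:
  "(\<And>i. i < n \<Longrightarrow> x i = x' i) \<Longrightarrow> (\<And>i. i < n \<Longrightarrow> y i = y' i) \<Longrightarrow> inner_n n x y = inner_n n x' y'"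
  unfolding inner_n_def by simp

lemma inner_n_le_mult:
  assumes "inner_n n x x \<le> a\<^sup>2" "inner_n n y y \<le> b\<^sup>2" "0 \<le> a" "0 \<le> b"
  shows "\<bar>inner_n n x y\<bar> \<le> a * b"
proof -
  have "norm_n n x \<le> a" "norm_n n y \<le> b"
    using assms by (metis norm_n_sq power2_le_imp_le)+
  thus ?thesis
    using inner_n_le_norm[of n x y] mult_mono[of "norm_n n x" a "norm_n n y" b] assms
    by (simp add: L2_set_nonneg)
qed

text \<open>The bilinear form of the matrix A^T A - I. Keeping two arguments makes polarization a
  matter of rewriting.\<close>

definition gram_defect ::
  "nat \<Rightarrow> nat \<Rightarrow> (nat \<Rightarrow> nat \<Rightarrow> real) \<Rightarrow> (nat \<Rightarrow> real) \<Rightarrow> (nat \<Rightarrow> real) \<Rightarrow> real" where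
  "gram_defect m n A x y = inner_n m (mat_vec m n A x) (mat_vec m n A y) - inner_n n x y"

lemma inner_mat_vec:
  "inner_n m (mat_vec m n A x) (mat_vec m n A y) = (\<Sum>i<m. inner_n n (A i) x * inner_n n (A i) y)"
  by (simp add: inner_n_def[of m] mat_vec_def)

lemma gram_defect_lincomb:
  "gram_defect m n A (\<lambda>i. a * x i + b * y i) z = a * gram_defect m n A x z + b * gram_defect m n A y z"
  unfolding gram_defect_def inner_mat_vec inner_n_lincomb inner_n_lincomb_right
  by (simp add: sum.distrib sum_distrib_left algebra_simps)

lemma gram_defect_commute: "gram_defect m n A x y = gram_defect m n A y x"
  unfolding gram_defect_def by (simp add: inner_n_commute)

lemma gram_defect_lincomb_right:
  "gram_defect m n A z (\<lambda>i. a * x i + b * y i) = a * gram_defect m n A z x + b * gram_defect m n A z y"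
  using gram_defect_lincomb[of m n A a x b y z] by (simp add: gram_defect_commute)

lemma gram_defect_cong:
  "(\<And>i. i < n \<Longrightarrow> x i = x' i) \<Longrightarrow> (\<And>i. i < n \<Longrightarrow> y i = y' i) \<Longrightarrow>
     gram_defect m n A x y = gram_defect m n A x' y'"
  unfolding gram_defect_def inner_mat_vec by (simp add: inner_n_def)

lemma gram_defect_scale: 
  "gram_defect m n A (\<lambda>i. a * x i) (\<lambda>i. b * y i) = a * b * gram_defect m n A x y"
  using gram_defect_lincomb[of m n A a x 0 x "\<lambda>i. b * y i"]
    gram_defect_lincomb_right[of m n A x b y 0 y] by simp

lemma inner_n_scale: "inner_n n (\<lambda>i. a * x i) (\<lambda>i. b * y i) = a * b * inner_n n x y"
  unfolding inner_n_def by (simp add: sum_distrib_left algebra_simps)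

text \<open>The restricted isometry property of order \<open>k\<close> with constant
  \<open>L\<close>. The vectors range over all functions because both sides only see entries below
  \<open>n\<close>.\<close>

definition rip :: "nat \<Rightarrow> nat \<Rightarrow> (nat \<Rightarrow> nat \<Rightarrow> real) \<Rightarrow> nat \<Rightarrow> real \<Rightarrow> bool" where
  "rip m n A k L \<longleftrightarrow> (\<forall>x. norm0 n x \<le> k \<longrightarrow> \<bar>gram_defect m n A x x\<bar> \<le> L * inner_n n x x)"

lemma norm0_le_card: "(\<And>i. i < n \<Longrightarrow> x i \<noteq> 0 \<Longrightarrow> i \<in> T) \<Longrightarrow> finite T \<Longrightarrow> norm0 n x \<le> card T"
  unfolding norm0_def by (rule card_mono) auto

text \<open>Polarization of x/a + y/b and x/a - y/b. By the parallelogram law their squared norms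
  add up to at most 4, and both vectors live on the joint support \<open>T\<close>.\<close>

lemma rip_bilinear:
  assumes rip: "rip m n A k L" and L: "0 \<le> L"
    and T: "finite T" "card T \<le> k" "\<And>i. i < n \<Longrightarrow> x i \<noteq> 0 \<or> y i \<noteq> 0 \<Longrightarrow> i \<in> T"
    and a: "0 < a" "inner_n n x x \<le> a\<^sup>2" and b: "0 < b" "inner_n n y y \<le> b\<^sup>2"
  shows "\<bar>gram_defect m n A x y\<bar> \<le> L * a * b"
proof -
  let ?p = "\<lambda>i. (1/a) * x i + (1/b) * y i" and ?q = "\<lambda>i. (1/a) * x i + (- (1/b)) * y i"
  have np: "norm0 n ?p \<le> k" "norm0 n ?q \<le> k"
    by (rule order_trans[OF norm0_le_card[OF T(3) T(1)] T(2)]; force)+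
  have e: "gram_defect m n A ?p ?p - gram_defect m n A ?q ?q = 4 / (a * b) * gram_defect m n A x y"
    unfolding gram_defect_lincomb gram_defect_lincomb_right gram_defect_commute[of m n A y x]
    using a b by (simp add: field_simps)
  have i: "inner_n n ?p ?p + inner_n n ?q ?q = 2 * (inner_n n x x / a\<^sup>2) + 2 * (inner_n n y y / b\<^sup>2)"
    unfolding inner_n_lincomb inner_n_lincomb_right inner_n_commute[of n y x]
    using a b by (simp add: field_simps power2_eq_square)
  have "inner_n n ?p ?p + inner_n n ?q ?q \<le> 4"
    unfolding i using a b by (smt (verit) divide_le_eq_1 zero_less_power)
  moreover have "\<bar>gram_defect m n A ?p ?p\<bar> \<le> L * inner_n n ?p ?p"
    "\<bar>gram_defect m n A ?q ?q\<bar> \<le> L * inner_n n ?q ?q"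
    using rip np unfolding rip_def by blast+
  ultimately have "\<bar>4 / (a * b) * gram_defect m n A x y\<bar> \<le> L * 4"
    unfolding e[symmetric] using mult_left_mono[of "inner_n n ?p ?p + inner_n n ?q ?q" 4 L] L
    unfolding distrib_left by linarith
  thus ?thesis using a b
    by (simp add: abs_mult field_simps)
qed

text \<open>Integer coordinates of the points \<open>grid_point k z\<close> in the unit ball, at
  mesh 1 / (4 sqrt k): rounding \<open>k\<close> coordinates then moves a vector by at most 1/4, and
  the ball becomes the bound 16 k on the sum of squares. The box places the grid inside a finite
  product, over which sums factorise.\<close>

definition sparse_grid :: "nat \<Rightarrow> nat \<Rightarrow> (nat \<Rightarrow> int) set" where
  "sparse_grid n k = {z \<in> {..<n} \<rightarrow>\<^sub>E {-16 * int k..16 * int k}.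
     card {i. i < n \<and> z i \<noteq> 0} \<le> k \<and> (\<Sum>i<n. (z i)\<^sup>2) \<le> 16 * int k}"

definition grid_point :: "nat \<Rightarrow> (nat \<Rightarrow> int) \<Rightarrow> nat \<Rightarrow> real" where
  "grid_point k z i = real_of_int (z i) / (4 * sqrt (real k))"

lemma inner_grid_point:
  assumes "z \<in> sparse_grid n k" "0 < k"
  shows "inner_n n (grid_point k z) (grid_point k z) \<le> 1"
proof -
  have "inner_n n (grid_point k z) (grid_point k z) = real_of_int (\<Sum>i<n. (z i)\<^sup>2) / (16 * real k)"
    unfolding inner_n_def grid_point_def
    by (simp add: sum_divide_distrib power2_eq_square)
  also have "\<dots> \<le> 1"
  proof -
    have "real_of_int (\<Sum>i<n. (z i)\<^sup>2) \<le> real_of_int (16 * int k)"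
      using assms(1) unfolding sparse_grid_def of_int_le_iff by simp
    thus ?thesis using assms(2) by simp
  qed
  finally show ?thesis .
qed

lemma abs_le_square_int: "\<bar>a\<bar> \<le> a\<^sup>2" for a :: int
proof (cases "a = 0")
  case False
  hence "\<bar>a\<bar> * 1 \<le> \<bar>a\<bar> * \<bar>a\<bar>" by (intro mult_left_mono) auto
  thus ?thesis by (simp add: power2_eq_square)
qed simp

text \<open>Rounding towards zero keeps the support and does not increase the norm.\<close>

lemma sparse_grid_approx:
  assumes x: "norm0 n x \<le> k" "inner_n n x x \<le> 1" and k: "0 < k"
  obtains z where "z \<in> sparse_grid n k" "\<And>i. i < n \<Longrightarrow> x i = 0 \<Longrightarrow> grid_point k z i = 0"
    "inner_n n (\<lambda>i. x i - grid_point k z i) (\<lambda>i. x i - grid_point k z i) \<le> 1 / 16"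
proof -
  define c where "c = 4 * sqrt (real k)"
  have c: "c > 0" "c\<^sup>2 = 16 * real k" using k by (auto simp: c_def power_mult_distrib)
  define r where "r = (\<lambda>y::real. if y \<ge> 0 then \<lfloor>y\<rfloor> else \<lceil>y\<rceil>)"
  have r1: "\<bar>y - r y\<bar> \<le> 1" for y
    unfolding r_def by (cases "y \<ge> 0"; simp; linarith)
  have r2: "\<bar>real_of_int (r y)\<bar> \<le> \<bar>y\<bar>" for y
  proof (cases "y \<ge> 0")
    case True
    hence "0 \<le> \<lfloor>y\<rfloor>" by simp
    thus ?thesis using True by (simp add: r_def)
  next
    case False
    hence "\<lceil>y\<rceil> \<le> 0" by simp
    thus ?thesis using False by (simp add: r_def) 
  qed
  define z where "z = (\<lambda>i\<in>{..<n}. r (c * x i))"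
  have zi: "z i = r (c * x i)" if "i < n" for i using that by (simp add: z_def)
  have z0: "z i = 0" if "i < n" "x i = 0" for i using that by (simp add: zi r_def)
  have sq: "(real_of_int (z i))\<^sup>2 \<le> c\<^sup>2 * (x i)\<^sup>2" if "i < n" for i
    using r2[of "c * x i"] that by (metis zi abs_le_square_iff power_mult_distrib)
  have "real_of_int (\<Sum>i<n. (z i)\<^sup>2) \<le> (\<Sum>i<n. c\<^sup>2 * (x i)\<^sup>2)"
    by (simp, rule sum_mono) (simp add: sq)
  also have "\<dots> = c\<^sup>2 * inner_n n x x"
    by (simp add: inner_n_def sum_distrib_left power2_eq_square)
  also have "\<dots> \<le> 16 * real k"
    using x c by (simp add: mult_left_le)
  finally have "real_of_int (\<Sum>i<n. (z i)\<^sup>2) \<le> real_of_int (16 * int k)" by simp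
  hence s: "(\<Sum>i<n. (z i)\<^sup>2) \<le> 16 * int k" by (simp only: of_int_le_iff)
  have bd: "\<bar>z i\<bar> \<le> 16 * int k" if "i < n" for i
  proof -
    have "\<bar>z i\<bar> \<le> (z i)\<^sup>2"
      by (rule abs_le_square_int)
    also have "\<dots> \<le> (\<Sum>i<n. (z i)\<^sup>2)" using that by (intro member_le_sum) auto
    finally show ?thesis using s by simp
  qed
  have card: "card {i. i < n \<and> z i \<noteq> 0} \<le> k"
  proof (rule order_trans[OF _ x(1)], unfold norm0_def, rule card_mono)
    show "{i. i < n \<and> z i \<noteq> 0} \<subseteq> {i. i < n \<and> x i \<noteq> 0}" using z0 by blast
  qed simp
  have zg: "z \<in> sparse_grid n k"
    unfolding sparse_grid_def using s card bd by (auto simp: PiE_iff abs_le_iff minus_le_iff) (simp add: z_def) 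
  have z1: "\<And>i. i < n \<Longrightarrow> x i = 0 \<Longrightarrow> grid_point k z i = 0"
    using z0 by (simp add: grid_point_def)
  let ?T = "{i. i < n \<and> x i \<noteq> 0}"
  have "inner_n n (\<lambda>i. x i - grid_point k z i) (\<lambda>i. x i - grid_point k z i)
      = (\<Sum>i\<in>?T. (x i - grid_point k z i)\<^sup>2)"
    unfolding inner_n_def power2_eq_square
    by (rule sum.mono_neutral_right) (auto simp: z1)
  also have "\<dots> \<le> (\<Sum>i\<in>?T. 1 / c\<^sup>2)"
  proof (rule sum_mono)
    fix i assume i: "i \<in> ?T"
    have "x i - grid_point k z i = (c * x i - z i) / c"
      using c by (simp add: grid_point_def c_def field_simps)
    moreover have "(c * x i - z i)\<^sup>2 \<le> 1"
      using i r1[of "c * x i"] by (simp add: zi abs_square_le_1)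
    ultimately show "(x i - grid_point k z i)\<^sup>2 \<le> 1 / c\<^sup>2"
      by (simp add: power_divide divide_right_mono)
  qed
  also have "\<dots> = real (norm0 n x) / (16 * real k)" by (simp add: norm0_def c)
  also have "\<dots> \<le> 1 / 16" using x k by (simp add: field_simps)
  finally show ?thesis using that zg z1 by blast
qed

text \<open>A crude bound depending on \<open>A\<close>. Its purpose is to make a supremum over the
  unit ball finite, so that it can be cancelled in an inequality with itself.\<close>

lemma gram_defect_bounded:
  assumes "inner_n n x x \<le> 1"
  shows "\<bar>gram_defect m n A x x\<bar> \<le> (\<Sum>i<m. inner_n n (A i) (A i)) + 1"
proof -
  have "(\<Sum>i<m. inner_n n (A i) x * inner_n n (A i) x) \<le> (\<Sum>i<m. inner_n n (A i) (A i))"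
  proof (rule sum_mono)
    fix i
    have "\<bar>inner_n n (A i) x\<bar> \<le> norm_n n (A i) * 1"
      using assms by (intro inner_n_le_mult) (auto simp: norm_n_sq)
    hence "(inner_n n (A i) x)\<^sup>2 \<le> (norm_n n (A i))\<^sup>2"
      by (simp add: abs_le_square_iff[symmetric])
    thus "inner_n n (A i) x * inner_n n (A i) x \<le> inner_n n (A i) (A i)"
      by (simp add: norm_n_sq power2_eq_square[symmetric])
  qed
  moreover have "0 \<le> (\<Sum>i<m. inner_n n (A i) x * inner_n n (A i) x)" by (simp add: sum_nonneg)
  ultimately show ?thesis
    unfolding gram_defect_def inner_mat_vec using assms inner_n_nonneg[of n x] by linarith
qed

text \<open>The best constant \<open>L\<close> bounds its own discretization error. If p is the grid
  point of x, then B x x - B p p = B (x - p) (x + p), where the factors have norms at most 1/4 and 2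
  and both live on the support of x, so the sparsity order does not grow. Hence
  \<open>L \<le> \<delta> + L / 2\<close>.\<close>

lemma rip_of_sparse_grid:
  assumes k: "0 < k"
    and grid: "\<And>z. z \<in> sparse_grid n k \<Longrightarrow> \<bar>gram_defect m n A (grid_point k z) (grid_point k z)\<bar> \<le> \<delta>"
  shows "rip m n A k (2 * \<delta>)"
proof -
  define S where "S = {x. norm0 n x \<le> k \<and> inner_n n x x \<le> 1}"
  define q where "q = (\<lambda>x. \<bar>gram_defect m n A x x\<bar>)"
  define L where "L = (SUP x\<in>S. q x)"
  have bdd: "bdd_above (q ` S)"
    unfolding q_def S_def by (rule bdd_aboveI2) (use gram_defect_bounded in blast)
  have qL: "q x \<le> L" if "x \<in> S" for x
    unfolding L_def using bdd that by (rule cSUP_upper2) simp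
  have zero: "(\<lambda>_. 0) \<in> S" by (auto simp: S_def norm0_def inner_n_def)
  have L0: "0 \<le> L" using qL[OF zero] unfolding q_def by linarith
  have ripL: "rip m n A k L" unfolding rip_def
  proof (intro allI impI)
    fix x assume x: "norm0 n x \<le> k"
    show "\<bar>gram_defect m n A x x\<bar> \<le> L * inner_n n x x"
    proof (cases "inner_n n x x = 0")
      case True
      hence "\<And>i. i < n \<Longrightarrow> x i = 0"
        unfolding inner_n_def by (subst (asm) sum_nonneg_eq_0_iff) auto
      hence "gram_defect m n A x x = gram_defect m n A (\<lambda>_. 0) (\<lambda>_. 0)"
        by (intro gram_defect_cong) auto
      thus ?thesis using True by (simp add: gram_defect_def inner_mat_vec) (simp add: inner_n_def)
    next
      case False
      define t where "t = norm_n n x"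
      have t: "t > 0" "t\<^sup>2 = inner_n n x x"
        using False L2_set_nonneg[of x "{..<n}"] unfolding t_def norm_n_sq[symmetric]
        by (auto simp: order_less_le)
      have "(\<lambda>i. (1/t) * x i) \<in> S"
        using x inner_n_scale[of n "1/t" x "1/t" x] t(1)
        unfolding S_def by (auto simp: norm0_def t(2)[symmetric] power2_eq_square)
      from qL[OF this] have "\<bar>gram_defect m n A x x\<bar> / t\<^sup>2 \<le> L"
        unfolding q_def gram_defect_scale using t(1) by (simp add: abs_mult power2_eq_square)
      thus ?thesis using t(1) unfolding t(2)[symmetric] by (simp add: field_simps)
    qed
  qed
  have "q x \<le> \<delta> + L / 2" if "x \<in> S" for x
  proof -
    have x: "norm0 n x \<le> k" "inner_n n x x \<le> 1" using that by (auto simp: S_def)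
    obtain z where z: "z \<in> sparse_grid n k" "\<And>i. i < n \<Longrightarrow> x i = 0 \<Longrightarrow> grid_point k z i = 0"
      and d: "inner_n n (\<lambda>i. x i - grid_point k z i) (\<lambda>i. x i - grid_point k z i) \<le> 1 / 16"
      using sparse_grid_approx[OF x k] by blast
    define p where "p = grid_point k z"
    \<comment> \<open>The coefficients 1 and -1 are written out so that the rules for linear
      combinations rewrite directly.\<close>
    define u v where "u = (\<lambda>i. 1 * x i + (-1) * p i)" and "v = (\<lambda>i. 1 * x i + 1 * p i)"
    have uv: "gram_defect m n A u v = gram_defect m n A x x - gram_defect m n A p p"
      unfolding u_def v_def gram_defect_lincomb gram_defect_lincomb_right gram_defect_commute[of m n A p x]
      by simp
    have pp: "inner_n n p p \<le> 1" using inner_grid_point[OF z(1) k] by (simp add: p_def)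
    have xp: "\<bar>inner_n n x p\<bar> \<le> 1 * 1" using x pp by (intro inner_n_le_mult) auto
    have "\<bar>gram_defect m n A u v\<bar> \<le> L * (1/4) * 2"
    proof (rule rip_bilinear[OF ripL L0, of "{i. i < n \<and> x i \<noteq> 0}"])
      show "inner_n n u u \<le> (1/4)\<^sup>2" using d by (simp add: u_def p_def power2_eq_square)
      show "inner_n n v v \<le> 2\<^sup>2"
        unfolding v_def inner_n_lincomb inner_n_lincomb_right using x pp xp
        by (simp add: inner_n_commute[of n p x])
    qed (use x z in \<open>auto simp: norm0_def u_def v_def p_def\<close>)
    moreover have "\<bar>gram_defect m n A p p\<bar> \<le> \<delta>" using grid z(1) by (simp add: p_def)
    ultimately show ?thesis unfolding q_def uv by linarith
  qed
  hence "L \<le> \<delta> + L / 2" unfolding L_def using zero by (intro cSUP_least) auto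
  hence "L \<le> 2 * \<delta>" by simp
  thus ?thesis using ripL unfolding rip_def
    by (meson inner_n_nonneg mult_right_mono order_trans)
qed

section \<open>Counting the sparse grid\<close>

lemma sum_half_powers: "(\<Sum>j\<in>{-int N..int N} - {0}. (1/2::real) ^ nat \<bar>j\<bar>) = 2 - 2 * (1/2) ^ N"
proof (induction N)
  case (Suc N)
  have *: "{-int (Suc N)..int (Suc N)} - {0} = insert (int (Suc N)) (insert (- int (Suc N)) ({-int N..int N} - {0}))"
    by auto
  have n: "nat \<bar>- 1 - int N\<bar> = Suc N" "nat (1 + int N) = Suc N" by auto
  show ?case unfolding * 
    by (subst sum.insert, simp, simp, subst sum.insert, simp, simp)
       (use Suc n in \<open>simp add: add.commute del: power_one_over\<close>)
qed simp

text \<open>With \<open>\<theta> = k / n \<le> 2\<close>, give \<open>z\<close> with support \<open>T\<close> the weight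
  \<open>2 ^ (17 * k) * (1 / \<theta>) ^ k * (\<Prod>i\<in>T. \<theta> * (1 / 2) ^ \<bar>z i\<bar>)\<close>. It is at least \<open>1\<close> on the grid, and its
  sum over all integer vectors factorises over the coordinates.\<close>

lemma card_sparse_grid:
  assumes k: "0 < k" "k \<le> 2 * n"
  shows "finite (sparse_grid n k)"
    and "real (card (sparse_grid n k)) \<le> 2 ^ (17 * k) * (real n / real k) ^ k * exp (2 * real k)"
proof -
  define I where "I = {-16 * int k..16 * int k}"
  have I_eq: "I = {- int (16 * k)..int (16 * k)}" by (simp add: I_def)
  have sub: "sparse_grid n k \<subseteq> {..<n} \<rightarrow>\<^sub>E I" by (auto simp: sparse_grid_def I_def)
  have fin: "finite ({..<n} \<rightarrow>\<^sub>E I)" by (intro finite_PiE) (auto simp: I_def)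
  show f: "finite (sparse_grid n k)" using sub fin by (rule finite_subset)
  define \<theta> where "\<theta> = real k / real n"
  have n: "n > 0" using k by auto
  have th: "0 < \<theta>" "\<theta> \<le> 2" using k n by (auto simp: \<theta>_def field_simps)
  define c where "c = (\<lambda>j::int. if j = 0 then 1 else \<theta> * (1/2::real) ^ nat \<bar>j\<bar>)"
  have c0: "c j \<ge> 0" for j using th by (simp add: c_def)
  define W where "W = 2 ^ (17 * k) * (1 / \<theta>) ^ k"
  have W0: "0 \<le> W" using th by (simp add: W_def)
  have w: "1 \<le> W * (\<Prod>i<n. c (z i))" if z: "z \<in> sparse_grid n k" for z
  proof -
    define T where "T = {i. i < n \<and> z i \<noteq> 0}"
    define p where "p = card T"
    have p: "p \<le> k" using z by (simp add: p_def T_def sparse_grid_def)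
    define s where "s = (\<Sum>i\<in>T. nat \<bar>z i\<bar>)"
    have "int s = (\<Sum>i\<in>T. \<bar>z i\<bar>)" by (simp add: s_def)
    also have "\<dots> \<le> (\<Sum>i\<in>T. (z i)\<^sup>2)"
      by (rule sum_mono) (rule abs_le_square_int)
    also have "\<dots> \<le> (\<Sum>i<n. (z i)\<^sup>2)" by (rule sum_mono2) (auto simp: T_def)
    also have "\<dots> \<le> 16 * int k" using z by (simp add: sparse_grid_def)
    finally have s: "s \<le> 16 * k" by simp
    have "(\<Prod>i<n. c (z i)) = (\<Prod>i\<in>T. c (z i))"
      by (rule prod.mono_neutral_right) (auto simp: T_def c_def)
    also have "\<dots> = (\<Prod>i\<in>T. \<theta> * (1/2) ^ nat \<bar>z i\<bar>)"
      by (rule prod.cong) (auto simp: T_def c_def)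
    also have "\<dots> = \<theta> ^ p * (1/2) ^ s"
      by (simp add: prod.distrib p_def s_def power_sum)
    finally have e: "(\<Prod>i<n. c (z i)) = \<theta> ^ p * (1/2) ^ s" .
    have "W * (\<theta> ^ p * (1/2) ^ s) = (2 ^ (16 * k) * (1/2) ^ s) * (2 ^ k * ((1 / \<theta>) ^ k * \<theta> ^ p))"
      by (simp add: W_def power_add[symmetric])
    also have "2 ^ (16 * k) * (1/2::real) ^ s = 2 ^ (16 * k - s)"
      using s by (simp add: power_diff power_divide)
    also have "(1 / \<theta>) ^ k * \<theta> ^ p = (1 / \<theta>) ^ (k - p)"
      using p th by (simp add: power_diff power_divide)
    \<comment> \<open>Since \<theta> may exceed 1, the power of 1/\<theta> alone may be less than 1.
      One factor 2 per coordinate repairs this because \<open>\<theta> \<le> 2\<close>; these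
      \<open>k\<close> factors and the 16 k that pay for the decay in \<open>s\<close> make up the
      exponent 17 k.\<close>
    also have "2 ^ k * (1 / \<theta>) ^ (k - p) = 2 ^ p * (2 / \<theta>) ^ (k - p)"
      using p by (simp add: power_divide power_add[symmetric])
    also have "1 \<le> (2::real) ^ (16 * k - s) * (2 ^ p * (2 / \<theta>) ^ (k - p))"
    proof -
      have "1 \<le> (2 / \<theta>) ^ (k - p)" using th by (intro one_le_power) simp
      hence "1 * 1 \<le> 2 ^ p * (2 / \<theta>) ^ (k - p)" by (intro mult_mono) auto
      hence "1 * 1 \<le> (2::real) ^ (16 * k - s) * (2 ^ p * (2 / \<theta>) ^ (k - p))" by (intro mult_mono) auto
      thus ?thesis by simp
    qed
    finally show ?thesis by (simp add: e)
  qed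
  have "real (card (sparse_grid n k)) = (\<Sum>z\<in>sparse_grid n k. 1)" by simp
  also have "\<dots> \<le> (\<Sum>z\<in>sparse_grid n k. W * (\<Prod>i<n. c (z i)))"
    by (rule sum_mono) (rule w)
  also have "\<dots> \<le> (\<Sum>z\<in>{..<n} \<rightarrow>\<^sub>E I. W * (\<Prod>i<n. c (z i)))"
    using fin sub W0 c0 by (intro sum_mono2) (auto intro!: mult_nonneg_nonneg prod_nonneg)
  also have "\<dots> = W * (\<Prod>i<n. \<Sum>j\<in>I. c j)"
    by (subst prod_sum_PiE) (auto simp: I_def sum_distrib_left)
  also have "(\<Sum>j\<in>I. c j) = 1 + (\<Sum>j\<in>I - {0}. \<theta> * (1/2::real) ^ nat \<bar>j\<bar>)"
    by (subst sum.remove[of _ 0]) (auto simp: I_def c_def intro!: sum.cong)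
  also have "\<dots> = 1 + \<theta> * (2 - 2 * (1/2) ^ (16 * k))"
    by (simp only: I_eq sum_half_powers sum_distrib_left[symmetric])
  \<comment> \<open>The choice of \<theta> as k / n pays off here: the \<open>n\<close> factors
    multiply to exp (2 k), free of \<open>n\<close>.\<close>
  also have "W * (\<Prod>i<n. 1 + \<theta> * (2 - 2 * (1/2) ^ (16 * k))) \<le> W * (\<Prod>i<n. exp (2 * \<theta>))"
  proof (intro mult_left_mono prod_mono conjI W0)
    fix i
    have a: "0 \<le> 2 - 2 * (1/2::real) ^ (16 * k)" by (simp add: power_le_one)
    show "0 \<le> 1 + \<theta> * (2 - 2 * (1/2) ^ (16 * k))" using a th by simp
    have "1 + \<theta> * (2 - 2 * (1/2) ^ (16 * k)) \<le> 1 + 2 * \<theta>" using th by simp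
    also have "\<dots> \<le> exp (2 * \<theta>)" by (rule exp_ge_add_one_self)
    finally show "1 + \<theta> * (2 - 2 * (1/2) ^ (16 * k)) \<le> exp (2 * \<theta>)" .
  qed
  also have "(\<Prod>i<n. exp (2 * \<theta>)) = exp (2 * real k)"
    using n by (simp add: exp_of_nat_mult[symmetric] \<theta>_def)
  also have "W = 2 ^ (17 * k) * (real n / real k) ^ k" by (simp add: W_def \<theta>_def)
  finally show "real (card (sparse_grid n k)) \<le> 2 ^ (17 * k) * (real n / real k) ^ k * exp (2 * real k)" .
qed

text \<open>Here 2 s may exceed n, so ln (n / k) can be negative, but it stays above - ln 2. This
  leaves F at least 0.3 k. The exponent of the count is at most F + 18 k, and 18 / 0.3 + 1 =
  61.\<close>

lemma card_sparse_grid_exp: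
  assumes s: "1 \<le> s" "s \<le> n"
  defines "F \<equiv> 2 * real s * ln (exp 1 * real n / (2 * real s))"
  shows "0 \<le> F" "real (card (sparse_grid n (2 * s))) \<le> exp (61 * F)"
proof -
  define k where "k = 2 * s"
  have k: "0 < k" "k \<le> 2 * n" and n: "0 < n" using s by (auto simp: k_def)
  have F: "F = real k * (1 + ln (real n / real k))"
  proof -
    have "exp 1 * real n / (2 * real s) = exp 1 * (real n / real k)" by (simp add: k_def)
    thus ?thesis unfolding F_def using k n by (simp add: ln_mult k_def del: times_divide_eq_right)
  qed
  have "ln (real n / real k) \<ge> ln (1 / 2)"
    using k n by (subst ln_le_cancel_iff) (auto simp: field_simps)
  hence l: "ln (real n / real k) \<ge> - 0.7" using ln2_le_25_over_36 by (simp add: ln_div)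
  have "F \<ge> real k * 0.3" unfolding F using l by (intro mult_left_mono) auto
  thus "0 \<le> F" using order_trans[of 0 "real k * 0.3" F] by simp
  have "real (card (sparse_grid n k)) \<le> 2 ^ (17 * k) * (real n / real k) ^ k * exp (2 * real k)"
    by (rule card_sparse_grid[OF k])
  also have "2 ^ (17 * k) = exp (17 * real k * ln 2)"
    using exp_of_nat_mult[of "17 * k" "ln 2 :: real"] by simp
  also have "(real n / real k) ^ k = exp (real k * ln (real n / real k))"
    using k n by (simp add: exp_of_nat_mult)
  also have "exp (17 * real k * ln 2) * exp (real k * ln (real n / real k)) * exp (2 * real k)
      = exp (17 * real k * ln 2 + real k * ln (real n / real k) + 2 * real k)"
    by (simp add: exp_add)
  also have "\<dots> \<le> exp (61 * F)"
  proof -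
    have "17 * real k * ln 2 \<le> 17 * real k * 1" using ln_2_less_1 by (intro mult_left_mono) auto
    moreover have "real k * ln (real n / real k) = F - real k" unfolding F by (simp add: algebra_simps)
    ultimately show ?thesis using \<open>F \<ge> real k * 0.3\<close> by simp
  qed
  finally show "real (card (sparse_grid n (2 * s))) \<le> exp (61 * F)" by (simp add: k_def)
qed

section \<open>Concentration of subexponential averages\<close>

lemma exp_le_quadratic: "exp x \<le> 1 + x + x\<^sup>2 / 2 * exp \<bar>x\<bar>" for x :: real
proof -
  obtain t where t: "\<bar>t\<bar> \<le> \<bar>x\<bar>" "exp x = (\<Sum>m<2. x ^ m / fact m) + exp t / fact 2 * x ^ 2"
    using Maclaurin_exp_le[of x 2] by blast
  have "exp t * x\<^sup>2 \<le> exp \<bar>x\<bar> * x\<^sup>2" using t(1) by (intro mult_right_mono) auto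
  thus ?thesis using t(2) by (simp add: eval_nat_numeral mult.commute)
qed

text \<open>Integrating 1 + Y/K \<le> exp (Y/K) gives the first claim. For the second, the linear
  term of the expansion of the exponential has mean 0. With w = Y + 1, the quadratic remainder costs
  exp (w/K): one half of the exponent absorbs the square, the other half absorbs exp |x|, hence the
  range 1 / (2 K) for \<open>l\<close>. The bound \<open>1 \<le> K\<close> turns exp (w/K) into at
  most e exp (Y/K).\<close>

lemma (in prob_space) subexponential_mgf:
  fixes Y :: "'a \<Rightarrow> real"
  assumes Y: "\<And>\<omega>. 0 \<le> Y \<omega>" "has_bochner_integral M Y 1"
    and K: "0 < K" "(\<integral>\<^sup>+\<omega>. ennreal (exp (Y \<omega> / K)) \<partial>M) \<le> 2"
  shows "1 \<le> K"
    and "\<bar>l\<bar> \<le> 1 / (2 * K) \<Longrightarrow>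
      (\<integral>\<^sup>+\<omega>. ennreal (exp (l * (Y \<omega> - 1))) \<partial>M) \<le> ennreal (exp (8 * exp 1 * K\<^sup>2 * l\<^sup>2))"
proof -
  have iY: "integrable M Y" "integral\<^sup>L M Y = 1" using Y(2) by (auto simp: has_bochner_integral_iff)
  have [measurable]: "Y \<in> borel_measurable M" using iY by auto
  have iE: "integrable M (\<lambda>\<omega>. exp (Y \<omega> / K))"
    using K(2) by (intro integrableI_nonneg) (auto intro: le_less_trans)
  have "ennreal (\<integral>\<omega>. exp (Y \<omega> / K) \<partial>M) \<le> ennreal 2"
    using K(2) nn_integral_eq_integral[OF iE] by simp
  hence E2: "(\<integral>\<omega>. exp (Y \<omega> / K) \<partial>M) \<le> 2" by (simp only: ennreal_le_iff)
  have "(\<integral>\<omega>. 1 + Y \<omega> / K \<partial>M) \<le> (\<integral>\<omega>. exp (Y \<omega> / K) \<partial>M)"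
    using iY iE by (intro integral_mono) auto
  hence "1 + 1 / K \<le> 2" using E2 iY by (simp add: prob_space)
  thus K1: "1 \<le> K" using K by (simp add: field_simps)
  assume l: "\<bar>l\<bar> \<le> 1 / (2 * K)"
  define g where "g = (\<lambda>\<omega>. 1 + l * (Y \<omega> - 1) + 4 * exp 1 * K\<^sup>2 * l\<^sup>2 * exp (Y \<omega> / K))"
  have ig: "integrable M g" unfolding g_def using iY iE by auto
  have "integral\<^sup>L M g = 1 + 4 * exp 1 * K\<^sup>2 * l\<^sup>2 * (\<integral>\<omega>. exp (Y \<omega> / K) \<partial>M)"
    unfolding g_def using iY iE by (simp add: prob_space)
  also have "\<dots> \<le> 1 + 4 * exp 1 * K\<^sup>2 * l\<^sup>2 * 2"
    using E2 by (intro add_left_mono mult_left_mono) auto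
  also have "\<dots> \<le> exp (8 * exp 1 * K\<^sup>2 * l\<^sup>2)"
    using exp_ge_add_one_self[of "8 * exp 1 * K\<^sup>2 * l\<^sup>2"] by (simp add: mult.assoc)
  finally have Ig: "integral\<^sup>L M g \<le> exp (8 * exp 1 * K\<^sup>2 * l\<^sup>2)" .
  have le: "exp (l * (Y \<omega> - 1)) \<le> g \<omega>" for \<omega>
  proof -
    define w where "w = Y \<omega> + 1"
    define x where "x = l * (Y \<omega> - 1)"
    have yw: "\<bar>Y \<omega> - 1\<bar> \<le> w" "0 \<le> w" using Y(1)[of \<omega>] by (auto simp: w_def)
    have "1 + w / (2 * K) + (w / (2 * K))\<^sup>2 / 2 \<le> exp (w / (2 * K))"
      using yw K by (intro exp_lower_Taylor_quadratic) auto
    moreover have "0 \<le> w / (2 * K)" using yw K by auto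
    ultimately have "(w / (2 * K))\<^sup>2 / 2 \<le> exp (w / (2 * K))" by linarith
    hence w2: "w\<^sup>2 \<le> 8 * K\<^sup>2 * exp (w / (2 * K))" using K by (simp add: field_simps power2_eq_square)
    have ax: "\<bar>x\<bar> \<le> w / (2 * K)"
    proof -
      have "\<bar>x\<bar> \<le> (1 / (2 * K)) * w" unfolding x_def abs_mult
        using l yw K by (intro mult_mono) auto
      thus ?thesis by simp
    qed
    have "\<bar>x\<bar> \<le> \<bar>l * w\<bar>" unfolding x_def abs_mult
      using yw by (intro mult_left_mono) auto
    hence "x\<^sup>2 \<le> l\<^sup>2 * w\<^sup>2" by (metis abs_le_square_iff power_mult_distrib)
    also have "\<dots> \<le> l\<^sup>2 * (8 * K\<^sup>2 * exp (w / (2 * K)))" by (intro mult_left_mono w2) auto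
    finally have "x\<^sup>2 / 2 * exp \<bar>x\<bar> \<le> (l\<^sup>2 * (8 * K\<^sup>2 * exp (w / (2 * K)))) / 2 * exp (w / (2 * K))"
      using ax by (intro mult_mono divide_right_mono) auto
    also have "\<dots> = 4 * K\<^sup>2 * l\<^sup>2 * exp (w / K)"
      by (simp add: exp_add[symmetric])
    also have "\<dots> \<le> 4 * K\<^sup>2 * l\<^sup>2 * (exp 1 * exp (Y \<omega> / K))"
    proof (intro mult_left_mono)
      have "w / K \<le> 1 + Y \<omega> / K" using K1 by (simp add: w_def add_divide_distrib)
      thus "exp (w / K) \<le> exp 1 * exp (Y \<omega> / K)" by (simp add: exp_add[symmetric])
    qed auto
    finally show ?thesis
      using exp_le_quadratic[of x] unfolding g_def x_def by (simp add: algebra_simps)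
  qed
  have g0: "0 \<le> g \<omega>" for \<omega> using le[of \<omega>] exp_ge_zero[of "l * (Y \<omega> - 1)"] by linarith
  have "(\<integral>\<^sup>+\<omega>. ennreal (exp (l * (Y \<omega> - 1))) \<partial>M) \<le> (\<integral>\<^sup>+\<omega>. ennreal (g \<omega>) \<partial>M)"
    by (intro nn_integral_mono ennreal_leI le)
  also have "\<dots> = ennreal (integral\<^sup>L M g)" using ig g0 by (intro nn_integral_eq_integral) auto
  also have "\<dots> \<le> ennreal (exp (8 * exp 1 * K\<^sup>2 * l\<^sup>2))" using Ig by (rule ennreal_leI)
  finally show "(\<integral>\<^sup>+\<omega>. ennreal (exp (l * (Y \<omega> - 1))) \<partial>M) \<le> ennreal (exp (8 * exp 1 * K\<^sup>2 * l\<^sup>2))" .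
qed

lemma (in prob_space) subexponential_tail:
  fixes Y :: "nat \<Rightarrow> 'a \<Rightarrow> real"
  assumes indep: "indep_vars (\<lambda>_. borel) Y {..<m}" and m: "0 < m"
    and Y: "\<And>i \<omega>. 0 \<le> Y i \<omega>" "\<And>i. i < m \<Longrightarrow> has_bochner_integral M (Y i) 1"
    and K: "0 < K" "\<And>i. i < m \<Longrightarrow> (\<integral>\<^sup>+\<omega>. ennreal (exp (Y i \<omega> / K)) \<partial>M) \<le> 2"
    and d: "0 < \<delta>" "\<delta> \<le> 1"
  shows "prob {\<omega> \<in> space M. \<bar>(\<Sum>i<m. Y i \<omega>) / real m - 1\<bar> > \<delta>}
           \<le> 2 * exp (- (real m * \<delta>\<^sup>2 / (32 * exp 1 * K\<^sup>2)))"
proof -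
  have [measurable]: "Y i \<in> borel_measurable M" if "i < m" for i
    using indep that by (auto simp: indep_vars_def)
  have K1: "1 \<le> K" using subexponential_mgf(1)[OF Y(1) Y(2)[OF m] K(1) K(2)[OF m]] .
  define c where "c = 8 * exp 1 * K\<^sup>2"
  have c: "c \<ge> K" "c > 0"
  proof -
    have "1 * (1 * K) \<le> (8 * exp 1) * (K * K)"
      using K1 exp_ge_add_one_self[of 1] by (intro mult_mono) auto
    thus "c \<ge> K" by (simp add: c_def power2_eq_square)
    thus "c > 0" using K by linarith
  qed
  have one: "emeasure M {\<omega> \<in> space M. \<sigma> * ((\<Sum>i<m. Y i \<omega>) - real m) \<ge> \<delta> * real m}
      \<le> ennreal (exp (- (real m * \<delta>\<^sup>2 / (4 * c))))" if s: "\<sigma> \<in> {1, -1}" for \<sigma>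
  proof -
    \<comment> \<open>The minimiser of the exponent c l^2 - l \<delta> per summand. As
      \<open>\<delta> \<le> 1\<close> and \<open>K \<le> c\<close>, it lies in the range where the
      moment bound is valid.\<close>
    define l where "l = \<delta> / (2 * c)"
    have l: "l > 0" using d c by (simp add: l_def)
    have ls: "\<bar>l * \<sigma>\<bar> \<le> 1 / (2 * K)" "(l * \<sigma>)\<^sup>2 = l\<^sup>2"
    proof -
      have "l \<le> 1 / (2 * K)" unfolding l_def using d c K by (intro frac_le) auto
      thus "\<bar>l * \<sigma>\<bar> \<le> 1 / (2 * K)" using s l by auto
      show "(l * \<sigma>)\<^sup>2 = l\<^sup>2" using s by auto
    qed
    have "emeasure M {\<omega> \<in> space M. \<sigma> * ((\<Sum>i<m. Y i \<omega>) - real m) \<ge> \<delta> * real m}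
        \<le> ennreal (exp (- l * (\<delta> * real m))) *
          (\<integral>\<^sup>+\<omega>\<in>space M. ennreal (exp (l * (\<sigma> * ((\<Sum>i<m. Y i \<omega>) - real m)))) \<partial>M)"
      using l by (intro Chernoff_ineq_nn_integral_ge) auto
    also have "(\<integral>\<^sup>+\<omega>\<in>space M. ennreal (exp (l * (\<sigma> * ((\<Sum>i<m. Y i \<omega>) - real m)))) \<partial>M)
        = (\<integral>\<^sup>+\<omega>. (\<Prod>i<m. ennreal (exp (l * \<sigma> * (Y i \<omega> - 1)))) \<partial>M)"
    proof (intro nn_integral_cong)
      fix \<omega> assume w: "\<omega> \<in> space M"
      have "(\<Prod>i<m. exp (l * \<sigma> * (Y i \<omega> - 1))) = exp (\<Sum>i<m. l * \<sigma> * (Y i \<omega> - 1))"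
        by (simp add: exp_sum)
      also have "(\<Sum>i<m. l * \<sigma> * (Y i \<omega> - 1)) = l * (\<sigma> * ((\<Sum>i<m. Y i \<omega>) - real m))"
        by (simp add: sum_distrib_left[symmetric] sum_subtractf)
      finally show "ennreal (exp (l * (\<sigma> * ((\<Sum>i<m. Y i \<omega>) - real m)))) * indicator (space M) \<omega>
          = (\<Prod>i<m. ennreal (exp (l * \<sigma> * (Y i \<omega> - 1))))"
        using w by (simp add: prod_ennreal)
    qed
    also have "\<dots> = (\<Prod>i<m. \<integral>\<^sup>+\<omega>. ennreal (exp (l * \<sigma> * (Y i \<omega> - 1))) \<partial>M)"
      by (intro indep_vars_nn_integral indep_vars_compose2[OF indep]) auto
    also have "ennreal (exp (- l * (\<delta> * real m))) * \<dots>
        \<le> ennreal (exp (- l * (\<delta> * real m))) * (\<Prod>i<m. ennreal (exp (c * l\<^sup>2)))"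
    proof (intro mult_left_mono prod_mono_ennreal)
      fix i assume "i \<in> {..<m}"
      hence i: "i < m" by simp
      show "(\<integral>\<^sup>+\<omega>. ennreal (exp (l * \<sigma> * (Y i \<omega> - 1))) \<partial>M) \<le> ennreal (exp (c * l\<^sup>2))"
        using subexponential_mgf(2)[OF Y(1) Y(2)[OF i] K(1) K(2)[OF i] ls(1)] ls(2)
        by (simp add: c_def)
    qed auto
    also have "\<dots> = ennreal (exp (- l * (\<delta> * real m)) * exp (real m * (c * l\<^sup>2)))"
      by (simp add: ennreal_mult ennreal_power exp_of_nat_mult)
    also have "exp (- l * (\<delta> * real m)) * exp (real m * (c * l\<^sup>2)) = exp (- (real m * \<delta>\<^sup>2 / (4 * c)))"
      unfolding exp_add[symmetric] l_def using c by (simp add: field_simps power2_eq_square)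
    finally show ?thesis .
  qed
  let ?A = "\<lambda>\<sigma>. {\<omega> \<in> space M. \<sigma> * ((\<Sum>i<m. Y i \<omega>) - real m) \<ge> \<delta> * real m}"
  have "{\<omega> \<in> space M. \<bar>(\<Sum>i<m. Y i \<omega>) / real m - 1\<bar> > \<delta>} \<subseteq> ?A 1 \<union> ?A (-1)"
    using m by (auto simp: abs_if field_simps split: if_splits)
  hence "prob {\<omega> \<in> space M. \<bar>(\<Sum>i<m. Y i \<omega>) / real m - 1\<bar> > \<delta>} \<le> prob (?A 1 \<union> ?A (-1))"
    by (intro finite_measure_mono) measurable
  also have "\<dots> \<le> prob (?A 1) + prob (?A (-1))" by (intro measure_Un_le) measurable
  also have "\<dots> \<le> exp (- (real m * \<delta>\<^sup>2 / (4 * c))) + exp (- (real m * \<delta>\<^sup>2 / (4 * c)))"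
    using one[of 1] one[of "-1"] by (intro add_mono) (auto simp: emeasure_eq_measure)
  finally show ?thesis by (simp add: c_def mult.assoc)
qed

section \<open>Restricted isometry of sub-Gaussian matrices\<close>

lemma inner_n_measurable_component:
  assumes "sets M = sets (Pi\<^sub>M {..<m} (\<lambda>_. Rn n))" "i < m"
  shows "(\<lambda>Q. inner_n n (Q i) u) \<in> borel_measurable M"
proof -
  have "(\<lambda>Q. Q i j) \<in> borel_measurable M" if "j < n" for j
  proof -
    have "(\<lambda>Q. Q i) \<in> measurable (Pi\<^sub>M {..<m} (\<lambda>_. Rn n)) (Rn n)" using assms(2) by (intro measurable_component_singleton) simp
    moreover have "(\<lambda>q. q j) \<in> measurable (Rn n) borel" using that by (intro measurable_component_singleton) simp
    ultimately have "(\<lambda>Q. Q i j) \<in> measurable (Pi\<^sub>M {..<m} (\<lambda>_. Rn n)) borel"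
      by (rule measurable_compose)
    thus ?thesis using measurable_cong_sets[OF assms(1) refl] by blast
  qed
  thus ?thesis unfolding inner_n_def by (intro borel_measurable_sum) auto
qed

lemma isotropic_second_moment:
  assumes "isotropic n M q"
  shows "has_bochner_integral M (\<lambda>\<omega>. (inner_n n (q \<omega>) u)\<^sup>2) (inner_n n u u)"
proof -
  have "has_bochner_integral M (\<lambda>\<omega>. \<Sum>j<n. \<Sum>k<n. (q \<omega> j * q \<omega> k) * (u j * u k))
      (\<Sum>j<n. \<Sum>k<n. (if j = k then 1 else 0) * (u j * u k))"
    using assms unfolding isotropic_def
    by (intro has_bochner_integral_sum has_bochner_integral_mult_left) auto
  also have "(\<Sum>j<n. \<Sum>k<n. (if j = k then 1 else 0) * (u j * u k)) = inner_n n u u"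
    unfolding inner_n_def by (simp add: if_distrib[where f = "\<lambda>x. x * _"] cong: if_cong)
  also have "(\<lambda>\<omega>. \<Sum>j<n. \<Sum>k<n. (q \<omega> j * q \<omega> k) * (u j * u k)) = (\<lambda>\<omega>. (inner_n n (q \<omega>) u)\<^sup>2)"
    unfolding inner_n_def power2_eq_square sum_product by (simp add: mult_ac)
  finally show ?thesis .
qed

text \<open>The strict inequality avoids the question whether the infimum is attained: some
  admissible value lies below \<open>t\<close>, and the integral decreases as the parameter
  grows.\<close>

lemma psi2_norm_less_imp:
  assumes "psi2_norm M Z < ennreal t" "0 < t"
  shows "(\<integral>\<^sup>+\<omega>. ennreal (exp ((Z \<omega>)\<^sup>2 / t\<^sup>2)) \<partial>M) \<le> 2"
proof -
  obtain r where r: "r > 0" "(\<integral>\<^sup>+\<omega>. ennreal (exp ((Z \<omega>)\<^sup>2 / r\<^sup>2)) \<partial>M) \<le> 2" "ennreal r < ennreal t"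
    using assms unfolding psi2_norm_def Inf_less_iff by auto
  have "r < t" using r by (simp add: ennreal_less_iff)
  have "(\<integral>\<^sup>+\<omega>. ennreal (exp ((Z \<omega>)\<^sup>2 / t\<^sup>2)) \<partial>M) \<le> (\<integral>\<^sup>+\<omega>. ennreal (exp ((Z \<omega>)\<^sup>2 / r\<^sup>2)) \<partial>M)"
    using r \<open>r < t\<close> by (intro nn_integral_mono ennreal_leI, subst exp_le_cancel_iff)
      (intro divide_left_mono power_mono mult_pos_pos zero_less_power, auto)
  thus ?thesis using r(2) by (rule order_trans)
qed

text \<open>The parameter is 2 \<kappa> instead of \<kappa>, because membership is available only
  strictly above the norm; its square is the denominator.\<close>

lemma subgaussian_row_moment:
  assumes "subgaussian_norm n M q = ennreal \<kappa>" "0 < \<kappa>" "norm_n n u = 1"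
  shows "(\<integral>\<^sup>+\<omega>. ennreal (exp ((inner_n n (q \<omega>) u)\<^sup>2 / (4 * \<kappa>\<^sup>2))) \<partial>M) \<le> 2"
proof -
  \<comment> \<open>The supremum in \<open>subgaussian_norm\<close> ranges over extensional vectors,
    whereas \<open>u\<close> is arbitrary beyond \<open>n\<close>.\<close>
  define v where "v = restrict u {..<n}"
  have v: "v \<in> space (Rn n)" by (auto simp: v_def space_PiM)
  have iv: "inner_n n x v = inner_n n x u" for x by (rule inner_n_cong) (auto simp: v_def)
  have "norm_n n v = norm_n n u" unfolding v_def by (rule L2_set_cong) auto
  hence "psi2_norm M (\<lambda>\<omega>. inner_n n (q \<omega>) v) \<le> subgaussian_norm n M q"
    unfolding subgaussian_norm_def using assms(3) v by (intro SUP_upper) auto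
  also have "\<dots> < ennreal (2 * \<kappa>)" using assms by (simp add: ennreal_less_iff)
  finally show ?thesis using psi2_norm_less_imp[of M _ "2 * \<kappa>"] assms(2)
    by (simp add: iv power_mult_distrib)
qed

abbreviation (input) scaled :: "nat \<Rightarrow> (nat \<Rightarrow> nat \<Rightarrow> real) \<Rightarrow> nat \<Rightarrow> nat \<Rightarrow> real" where
  "scaled m Q \<equiv> \<lambda>i j. 1 / sqrt (real m) * Q i j"

lemma gram_defect_scaled:
  assumes "0 < m"
  shows "gram_defect m n (scaled m Q) x x = (\<Sum>i<m. (inner_n n (Q i) x)\<^sup>2) / real m - inner_n n x x"
proof -
  have "inner_n n (\<lambda>j. 1 / sqrt (real m) * Q i j) x = inner_n n (Q i) x / sqrt (real m)" for i
    unfolding inner_n_def by (simp add: sum_divide_distrib)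
  thus ?thesis using assms unfolding gram_defect_def inner_mat_vec
    by (simp add: sum_divide_distrib power2_eq_square)
qed

lemma gram_defect_measurable:
  assumes "sets M = sets (Pi\<^sub>M {..<m} (\<lambda>_. Rn n))" "0 < m"
  shows "(\<lambda>Q. gram_defect m n (scaled m Q) x x) \<in> borel_measurable M"
  unfolding gram_defect_scaled[OF assms(2)]
  using inner_n_measurable_component[OF assms(1)]
  by (intro borel_measurable_diff borel_measurable_divide borel_measurable_sum borel_measurable_power) auto

context
  fixes m n :: nat and \<kappa> :: real and M :: "(nat \<Rightarrow> nat \<Rightarrow> real) measure"
  assumes law: "subgaussian_matrix_law m n \<kappa> M" and \<kappa>: "0 < \<kappa>" and m: "0 < m"
begin

interpretation prob_space M using law by (simp add: subgaussian_matrix_law_def)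

text \<open>For a unit vector, the squares of the row products have mean 1 by isotropy and are
  subexponential with K = 4 \<kappa>^2, so 32 e K^2 = 512 e \<kappa>^4. Grid points may be shorter
  than 1; normalising them only enlarges the defect.\<close>

lemma subgaussian_gram_tail:
  assumes u: "inner_n n u u \<le> 1" and d: "0 < \<delta>" "\<delta> \<le> 1"
  shows "measure M {Q \<in> space M. \<bar>gram_defect m n (scaled m Q) u u\<bar> > \<delta>}
           \<le> 2 * exp (- (real m * \<delta>\<^sup>2 / (512 * exp 1 * \<kappa> ^ 4)))"
proof -
  have S: "sets M = sets (Pi\<^sub>M {..<m} (\<lambda>_. Rn n))" using law by (simp add: subgaussian_matrix_law_def)
  have unit: "measure M {Q \<in> space M. \<bar>gram_defect m n (scaled m Q) u u\<bar> > \<delta>}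
           \<le> 2 * exp (- (real m * \<delta>\<^sup>2 / (512 * exp 1 * \<kappa> ^ 4)))" if u: "inner_n n u u = 1" for u
  proof -
    have nu: "norm_n n u = 1"
      using u power2_eq_iff_nonneg[of "norm_n n u" 1] by (simp add: norm_n_sq L2_set_nonneg)
    define Y where "Y = (\<lambda>i (Q :: nat \<Rightarrow> nat \<Rightarrow> real). (inner_n n (Q i) u)\<^sup>2)"
    have ind: "indep_vars (\<lambda>_. Rn n) (\<lambda>i Q. Q i) {..<m}"
      using law by (simp add: subgaussian_matrix_law_def)
    have indep: "indep_vars (\<lambda>_. borel) Y {..<m}"
      unfolding Y_def inner_n_def
      by (rule indep_vars_compose2[OF ind, of "\<lambda>_ q. (\<Sum>i<n. q i * u i)\<^sup>2"]) measurable
    have "prob {Q \<in> space M. \<bar>(\<Sum>i<m. Y i Q) / real m - 1\<bar> > \<delta>}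
           \<le> 2 * exp (- (real m * \<delta>\<^sup>2 / (32 * exp 1 * (4 * \<kappa>\<^sup>2)\<^sup>2)))"
    proof (rule subexponential_tail[OF indep m _ _ _ _ d])
      show "has_bochner_integral M (Y i) 1" if "i < m" for i
        unfolding Y_def u[symmetric] using law that
        by (intro isotropic_second_moment) (simp add: subgaussian_matrix_law_def)
      show "(\<integral>\<^sup>+Q. ennreal (exp (Y i Q / (4 * \<kappa>\<^sup>2))) \<partial>M) \<le> 2" if "i < m" for i
        unfolding Y_def using law that \<kappa> nu
        by (intro subgaussian_row_moment) (simp_all add: subgaussian_matrix_law_def)
    qed (use \<kappa> in \<open>auto simp: Y_def\<close>)
    thus ?thesis unfolding gram_defect_scaled[OF m] u Y_def
      by (simp add: power_mult_distrib mult.assoc flip: power_mult)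
  qed
  show ?thesis
  proof (cases "inner_n n u u = 0")
    case True
    hence "\<And>i. i < n \<Longrightarrow> u i = 0"
      unfolding inner_n_def by (subst (asm) sum_nonneg_eq_0_iff) auto
    hence "inner_n n (Q i) u = 0" for Q :: "nat \<Rightarrow> nat \<Rightarrow> real" and i by (simp add: inner_n_def)
    thus ?thesis unfolding gram_defect_scaled[OF m] True using d by simp
  next
    case False
    define t where "t = norm_n n u"
    have t: "t > 0" "t\<^sup>2 = inner_n n u u"
      using False L2_set_nonneg[of u "{..<n}"] unfolding t_def norm_n_sq[symmetric]
      by (auto simp: order_less_le)
    define v where "v = (\<lambda>i. (1/t) * u i)"
    have v: "inner_n n v v = 1"
      unfolding v_def inner_n_scale t(2)[symmetric] using t(1) by (simp add: power2_eq_square)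
    have le: "\<bar>gram_defect m n A u u\<bar> \<le> \<bar>gram_defect m n A v v\<bar>" for A
    proof -
      have "gram_defect m n A v v = gram_defect m n A u u / t\<^sup>2"
        unfolding v_def gram_defect_scale by (simp add: power2_eq_square)
      hence "\<bar>gram_defect m n A u u\<bar> = t\<^sup>2 * \<bar>gram_defect m n A v v\<bar>" using t(1) by (simp add: abs_mult)
      also have "\<dots> \<le> 1 * \<bar>gram_defect m n A v v\<bar>" using t u by (intro mult_right_mono) auto
      finally show ?thesis by simp
    qed
    have [measurable]: "(\<lambda>Q. gram_defect m n (scaled m Q) v v) \<in> borel_measurable M"
      by (rule gram_defect_measurable[OF S m])
    have "measure M {Q \<in> space M. \<bar>gram_defect m n (scaled m Q) u u\<bar> > \<delta>}
        \<le> measure M {Q \<in> space M. \<bar>gram_defect m n (scaled m Q) v v\<bar> > \<delta>}"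
    proof (rule finite_measure_mono)
      show "{Q \<in> space M. \<delta> < \<bar>gram_defect m n (scaled m Q) v v\<bar>} \<in> events" by measurable
    qed (use le in \<open>auto intro: less_le_trans\<close>)
    thus ?thesis using unit[OF v] by linarith
  qed
qed

text \<open>The factor 31232 = 61 * 512 makes the tail exponent at least 61 (F + ln (2 /
  \<epsilon>)): 61 F cancels the number of grid points, and the rest covers the factor 2 and
  \<epsilon>. As \<open>rip\<close> quantifies over uncountably many vectors, a measurable
  exceptional set is produced in place of its complement.\<close>

lemma rip_probability:
  assumes s: "1 \<le> s" "s \<le> n" and d: "0 < \<delta>" "\<delta> \<le> 1" and e: "0 < \<epsilon>" "\<epsilon> < 1"
    and large: "31232 * exp 1 * \<kappa> ^ 4 *
      (2 * real s * ln (exp 1 * real n / (2 * real s)) + ln (2 * inverse \<epsilon>)) \<le> real m * \<delta>\<^sup>2"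
  obtains B where "B \<in> sets M" "measure M B \<le> \<epsilon>"
    "\<And>Q. Q \<in> space M - B \<Longrightarrow> rip m n (scaled m Q) (2 * s) (2 * \<delta>)"
proof -
  have S: "sets M = sets (Pi\<^sub>M {..<m} (\<lambda>_. Rn n))" using law by (simp add: subgaussian_matrix_law_def)
  define k where "k = 2 * s"
  have k: "0 < k" "k \<le> 2 * n" using s by (auto simp: k_def)
  define F where "F = 2 * real s * ln (exp 1 * real n / (2 * real s))"
  have F: "0 \<le> F" "real (card (sparse_grid n k)) \<le> exp (61 * F)"
    using card_sparse_grid_exp[OF s] by (auto simp: F_def k_def)
  define D where "D = (\<lambda>z. {Q \<in> space M. \<bar>gram_defect m n (scaled m Q) (grid_point k z) (grid_point k z)\<bar> > \<delta>})"
  define B where "B = (\<Union>z\<in>sparse_grid n k. D z)"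
  have fin: "finite (sparse_grid n k)" by (rule card_sparse_grid(1)[OF k])
  have D: "D z \<in> sets M" for z
  proof -
    have [measurable]: "(\<lambda>Q. gram_defect m n (scaled m Q) (grid_point k z) (grid_point k z)) \<in> borel_measurable M"
      by (rule gram_defect_measurable[OF S m])
    show ?thesis unfolding D_def by measurable
  qed
  define a where "a = real m * \<delta>\<^sup>2 / (512 * exp 1 * \<kappa> ^ 4)"
  have a: "61 * (F + ln (2 / \<epsilon>)) \<le> a"
    using large \<kappa> by (simp add: a_def F_def field_simps)
  have l0: "0 \<le> ln (2 / \<epsilon>)" using e by simp
  have "measure M B \<le> (\<Sum>z\<in>sparse_grid n k. measure M (D z))"
    unfolding B_def using fin D by (intro finite_measure_subadditive_finite) auto
  also have "\<dots> \<le> (\<Sum>z\<in>sparse_grid n k. 2 * exp (- a))"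
    unfolding D_def a_def by (intro sum_mono subgaussian_gram_tail inner_grid_point k d)
  also have "\<dots> = real (card (sparse_grid n k)) * (2 * exp (- a))" by simp
  also have "\<dots> \<le> exp (61 * F) * (2 * exp (- a))" using F by (intro mult_right_mono) auto
  also have "\<dots> = 2 * exp (61 * F - a)" by (simp add: exp_diff exp_minus field_simps)
  also have "\<dots> \<le> 2 * exp (- ln (2 / \<epsilon>))"
    using a l0 by simp
  also have "\<dots> = \<epsilon>" using e by (simp add: exp_minus)
  finally have mB: "measure M B \<le> \<epsilon>" .
  show ?thesis
  proof (rule that[OF _ mB])
    show "B \<in> sets M" unfolding B_def using fin D by auto
    fix Q assume Q: "Q \<in> space M - B"
    show "rip m n (scaled m Q) (2 * s) (2 * \<delta>)"
    proof (rule rip_of_sparse_grid)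
      fix z assume "z \<in> sparse_grid n (2 * s)"
      hence "Q \<notin> D z" using Q by (auto simp: B_def k_def)
      thus "\<bar>gram_defect m n (scaled m Q) (grid_point (2 * s) z) (grid_point (2 * s) z)\<bar> \<le> \<delta>"
        using Q by (auto simp: D_def k_def)
    qed (use s in simp)
  qed
qed

end

section \<open>Supports of labelled data\<close>

text \<open>Finite products of sets from a countable base of the line. They link topology and
  \<sigma>-algebra: open sets become countable unions of measurable boxes.\<close>

lemma Rn_top_countable_base:
  obtains \<B> where "countable \<B>" "\<And>U. U \<in> \<B> \<Longrightarrow> U \<in> sets (Rn n)"
    "\<And>A x. openin (Rn_top n) A \<Longrightarrow> x \<in> A \<Longrightarrow> \<exists>U\<in>\<B>. x \<in> U \<and> U \<subseteq> A"
proof -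
  obtain B :: "real set set" where B: "countable B" "topological_basis B"
    using ex_countable_basis by blast
  define \<B> where "\<B> = (\<lambda>f. Pi\<^sub>E {..<n} f) ` ({..<n} \<rightarrow>\<^sub>E B)"
  show ?thesis
  proof
    show "countable \<B>" unfolding \<B>_def using B by (intro countable_image countable_PiE) auto
    show "U \<in> sets (Rn n)" if U: "U \<in> \<B>" for U
    proof -
      obtain f where f: "f \<in> {..<n} \<rightarrow>\<^sub>E B" "U = Pi\<^sub>E {..<n} f" using U unfolding \<B>_def by blast
      have "f i \<in> sets borel" if "i < n" for i
        using f(1) that B(2) by (auto intro!: borel_open topological_basis_open simp: PiE_iff)
      thus ?thesis unfolding f(2) by (intro sets_PiM_I_finite) auto
    qed
    show "\<exists>U\<in>\<B>. x \<in> U \<and> U \<subseteq> A" if A: "openin (Rn_top n) A" "x \<in> A" for A x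
    proof -
      obtain V where V: "\<And>i. i < n \<Longrightarrow> open (V i)" "x \<in> Pi\<^sub>E {..<n} V" "Pi\<^sub>E {..<n} V \<subseteq> A"
      proof -
        have "\<exists>U. (\<forall>i\<in>{..<n}. open (U i)) \<and> x \<in> Pi\<^sub>E {..<n} U \<and> Pi\<^sub>E {..<n} U \<subseteq> A"
          using A unfolding openin_product_topology_alt by (auto simp: open_openin[symmetric])
        thus ?thesis using that by blast
      qed
      have "\<exists>W. W \<in> B \<and> x i \<in> W \<and> W \<subseteq> V i" if "i < n" for i
        using topological_basisE[OF B(2) V(1)[OF that], of "x i"] V(2) that by (metis PiE_mem lessThan_iff)
      then obtain W where W: "\<And>i. i < n \<Longrightarrow> W i \<in> B \<and> x i \<in> W i \<and> W i \<subseteq> V i" by metis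
      define f where "f = restrict W {..<n}"
      have "f \<in> {..<n} \<rightarrow>\<^sub>E B" using W by (auto simp: f_def)
      hence "Pi\<^sub>E {..<n} f \<in> \<B>" unfolding \<B>_def by (rule imageI)
      moreover have "Pi\<^sub>E {..<n} f \<subseteq> Pi\<^sub>E {..<n} V" using W by (intro PiE_mono) (auto simp: f_def)
      moreover have "x \<in> Pi\<^sub>E {..<n} f" using W V(2) by (auto simp: f_def PiE_iff)
      ultimately show ?thesis using V(3) by (meson order_trans)
    qed
  qed
qed

lemma openin_Rn_top_sets:
  assumes "openin (Rn_top n) A"
  shows "A \<in> sets (Rn n)"
proof -
  obtain \<B> where B: "countable \<B>" "\<And>U. U \<in> \<B> \<Longrightarrow> U \<in> sets (Rn n)"
    "\<And>A x. openin (Rn_top n) A \<Longrightarrow> x \<in> A \<Longrightarrow> \<exists>U\<in>\<B>. x \<in> U \<and> U \<subseteq> A"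
    using Rn_top_countable_base by blast
  have "A = \<Union>{U \<in> \<B>. U \<subseteq> A}" using B(3)[OF assms] by blast
  moreover have "\<Union>{U \<in> \<B>. U \<subseteq> A} \<in> sets (Rn n)"
    using B(1,2) by (intro sets.countable_Union countable_Collect) auto
  ultimately show ?thesis by simp
qed

context
  fixes n :: nat and \<mu> :: "((nat \<Rightarrow> real) \<times> real) measure"
  assumes prob: "prob_space \<mu>" and sets_\<mu>: "sets \<mu> = sets (Rn_labelled n)"
begin

interpretation prob_space \<mu> by (rule prob)

lemma space_labelled: "space \<mu> = space (Rn n) \<times> {-1, 1}"
  using sets_eq_imp_space_eq[OF sets_\<mu>] by (simp add: space_pair_measure)

lemma times_label_sets: "A \<in> sets (Rn n) \<Longrightarrow> l \<in> {-1, 1} \<Longrightarrow> A \<times> {l} \<in> sets \<mu>"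
  unfolding sets_\<mu> by (intro pair_measureI) auto

text \<open>A point outside the support of its label has a null neighbourhood, hence lies in a null
  box of the base, and there are only countably many such boxes for each label.\<close>

lemma AE_label_support: "AE p in \<mu>. fst p \<in> label_support n \<mu> (snd p)"
proof -
  obtain \<B> where B: "countable \<B>" "\<And>U. U \<in> \<B> \<Longrightarrow> U \<in> sets (Rn n)"
    "\<And>A x. openin (Rn_top n) A \<Longrightarrow> x \<in> A \<Longrightarrow> \<exists>U\<in>\<B>. x \<in> U \<and> U \<subseteq> A"
    using Rn_top_countable_base by blast
  define N where "N = (\<Union>(U, l) \<in> {(U, l) \<in> \<B> \<times> {-1, 1}. measure \<mu> (U \<times> {l}) = 0}. U \<times> {l})"
  have "N \<in> null_sets \<mu>"
    unfolding N_def
  proof (rule null_sets_UN')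
    show "countable {(U, l) \<in> \<B> \<times> {-1, 1}. measure \<mu> (U \<times> {l}) = 0}"
      by (rule countable_subset[of _ "\<B> \<times> {-1, 1}"]) (use B(1) in auto)
  next
    fix p assume "p \<in> {(U, l) \<in> \<B> \<times> {-1, 1}. measure \<mu> (U \<times> {l}) = 0}"
    then obtain U l where "p = (U, l)" "U \<in> \<B>" "l \<in> {-1, 1}" "measure \<mu> (U \<times> {l}) = 0" by auto
    thus "(case p of (U, l) \<Rightarrow> U \<times> {l}) \<in> null_sets \<mu>"
      using times_label_sets B(2) by (auto simp: null_sets_def emeasure_eq_measure)
  qed
  moreover have "fst p \<in> label_support n \<mu> (snd p)" if p: "p \<in> space \<mu> - N" for p
  proof (rule ccontr)
    obtain x y where xy: "p = (x, y)" by (cases p)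
    have x: "x \<in> space (Rn n)" and y: "y \<in> {-1, 1}" using p unfolding xy space_labelled by auto
    assume "fst p \<notin> label_support n \<mu> (snd p)"
    then obtain A where A: "openin (Rn_top n) A" "x \<in> A" "\<not> measure \<mu> (A \<times> {y}) > 0"
      using x unfolding xy label_support_def by auto
    obtain U where U: "U \<in> \<B>" "x \<in> U" "U \<subseteq> A" using B(3)[OF A(1,2)] by blast
    have "measure \<mu> (U \<times> {y}) \<le> measure \<mu> (A \<times> {y})"
      using U y openin_Rn_top_sets[OF A(1)] by (intro finite_measure_mono times_label_sets) auto
    hence "measure \<mu> (U \<times> {y}) = 0" using A(3) measure_nonneg[of \<mu> "U \<times> {y}"] by linarith
    hence "p \<in> N" unfolding N_def xy using U y by auto
    thus False using p by blast
  qed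
  ultimately show ?thesis by (intro AE_I'[of N]) auto
qed

lemma inner_n_measurable: "(\<lambda>x. inner_n n w x) \<in> borel_measurable (Rn n)"
  unfolding inner_n_def by measurable

lemma margin_measurable:
  assumes f: "f \<in> borel_measurable (Rn n)"
  shows "(\<lambda>p. snd p * (f (fst p) + b)) \<in> borel_measurable \<mu>"
proof -
  have "(\<lambda>p. snd p) \<in> borel_measurable (Rn_labelled n)"
    by (rule measurable_compose[OF measurable_snd borel_measurable_count_space])
  moreover have "(\<lambda>p. f (fst p)) \<in> borel_measurable (Rn_labelled n)"
    by (rule measurable_compose[OF measurable_fst f])
  ultimately show ?thesis unfolding measurable_cong_sets[OF sets_\<mu> refl]
    by (intro borel_measurable_times borel_measurable_add borel_measurable_const)
qed

lemma prob_margin_iff: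
  assumes f: "f \<in> borel_measurable (Rn n)"
  shows "measure \<mu> {(x, y) \<in> space \<mu>. y * (f x + b) \<ge> c} = 1 \<longleftrightarrow> (AE p in \<mu>. snd p * (f (fst p) + b) \<ge> c)"
proof -
  have [measurable]: "(\<lambda>p. snd p * (f (fst p) + b)) \<in> borel_measurable \<mu>" by (rule margin_measurable[OF f])
  have "{p \<in> space \<mu>. snd p * (f (fst p) + b) \<ge> c} \<in> sets \<mu>" by measurable
  moreover have "{(x, y) \<in> space \<mu>. y * (f x + b) \<ge> c} = {p \<in> space \<mu>. snd p * (f (fst p) + b) \<ge> c}"
    by auto
  ultimately show ?thesis using prob_Collect_eq_1 by simp
qed

text \<open>An almost sure inequality becomes pointwise on the support: by continuity the points
  violating it form an open set, which is null together with the label and so cannot contain a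
  support point.\<close>

lemma label_support_margin:
  assumes sep: "separable_by n \<mu> w b" and x: "x \<in> label_support n \<mu> l" and l: "l \<in> {-1, 1}"
  shows "1 \<le> l * (inner_n n w x + b)"
proof (rule ccontr)
  assume neg: "\<not> ?thesis"
  define A where "A = {z \<in> topspace (Rn_top n). l * (inner_n n w z + b) \<in> {..<1}}"
  have "continuous_map (Rn_top n) euclideanreal (\<lambda>z. l * (inner_n n w z + b))"
    unfolding inner_n_def
    by (intro continuous_map_real_mult continuous_map_add continuous_map_sum continuous_map_product_projection)
       auto
  hence A: "openin (Rn_top n) A" unfolding A_def by (rule openin_continuous_map_preimage) simp
  moreover have "x \<in> A" using x neg by (auto simp: A_def label_support_def space_PiM)
  ultimately have pos: "measure \<mu> (A \<times> {l}) > 0" using x by (simp add: label_support_def)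
  have "AE p in \<mu>. 1 \<le> snd p * (inner_n n w (fst p) + b)"
    using sep unfolding separable_by_def prob_margin_iff[OF inner_n_measurable] .
  hence "AE p in \<mu>. p \<notin> A \<times> {l}"
  proof (rule eventually_mono)
    fix p assume p: "1 \<le> snd p * (inner_n n w (fst p) + b)"
    show "p \<notin> A \<times> {l}"
    proof
      assume "p \<in> A \<times> {l}"
      hence "fst p \<in> A" "snd p = l" by auto
      thus False using p unfolding A_def by auto
    qed
  qed
  hence "A \<times> {l} \<in> null_sets \<mu>"
    using AE_iff_null_sets[OF times_label_sets[OF openin_Rn_top_sets[OF A] l]] by blast
  hence "measure \<mu> (A \<times> {l}) = 0" by (rule measure_eq_0_null_sets)
  thus False using pos by simp
qed

end

section \<open>Separation after compression\<close>

text \<open>The variational inequality for the point of a convex set nearest to the origin, with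
  slack since the infimum need not be attained. Moving from \<open>w\<close> towards
  \<open>v\<close> by a step \<open>t\<close> cannot push the squared norm below \<rho>; the bound
  \<open>V\<close> lets one \<open>w\<close> and one \<open>t\<close> serve all
  \<open>v\<close>.\<close>

lemma near_minimal_norm:
  assumes conv: "\<And>u v t. u \<in> K \<Longrightarrow> v \<in> K \<Longrightarrow> 0 \<le> t \<Longrightarrow> t \<le> 1 \<Longrightarrow> (\<lambda>i. (1 - t) * u i + t * v i) \<in> K"
    and K: "K \<noteq> {}" and a: "0 < a" "\<And>w. w \<in> K \<Longrightarrow> a \<le> inner_n n w w" and V: "0 \<le> V"
  shows "\<exists>w\<in>K. \<forall>v\<in>K. inner_n n v v \<le> V \<longrightarrow> a / 2 \<le> inner_n n w v"
proof -
  define \<rho> where "\<rho> = (INF w\<in>K. inner_n n w w)"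
  have bdd: "bdd_below ((\<lambda>w. inner_n n w w) ` K)" using a by (intro bdd_belowI2) auto
  have \<rho>: "a \<le> \<rho>" unfolding \<rho>_def using K a by (intro cINF_greatest) auto
  define M where "M = 2 * V + 2 * (\<rho> + 1)"
  have M: "M > 0" "a \<le> M" using V a \<rho> by (auto simp: M_def)
  \<comment> \<open>The step makes the second-order term t^2 M equal to t a / 2, where
    \<open>M\<close> bounds |v - w|^2 by the parallelogram law.\<close>
  define t where "t = a / (2 * M)"
  have t: "0 < t" "t \<le> 1" "t * M = a / 2" using M a by (auto simp: t_def field_simps)
  \<comment> \<open>The bound 1 ensures |w|^2 \<le> \<rho> + 1, on which \<open>M\<close> relies;
    the other bound keeps the error of near-minimality within t a / 2.\<close>
  define \<eta> where "\<eta> = min 1 (t * a / 2)"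
  have \<eta>: "0 < \<eta>" "\<eta> \<le> 1" "\<eta> \<le> t * a / 2" using t a by (auto simp: \<eta>_def)
  obtain w where w: "w \<in> K" "inner_n n w w < \<rho> + \<eta>"
    using cInf_lessD[of "(\<lambda>w. inner_n n w w) ` K" "\<rho> + \<eta>"] K \<eta> unfolding \<rho>_def by auto
  have wr: "\<rho> \<le> inner_n n w w" unfolding \<rho>_def using bdd w by (intro cINF_lower)
  have "a / 2 \<le> inner_n n w v" if v: "v \<in> K" "inner_n n v v \<le> V" for v
  proof -
    define d e where "d = (\<lambda>i. 1 * v i + (-1) * w i)" and "e = (\<lambda>i. 1 * v i + 1 * w i)"
    define z where "z = (\<lambda>i. (1 - t) * w i + t * v i)"
    have "z \<in> K" unfolding z_def using conv w v t by simp
    hence "\<rho> \<le> inner_n n z z" unfolding \<rho>_def using bdd by (intro cINF_lower)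
    also have "inner_n n z z = inner_n n w w + 2 * t * (inner_n n w v - inner_n n w w) + t\<^sup>2 * inner_n n d d"
      unfolding z_def d_def inner_n_lincomb inner_n_lincomb_right inner_n_commute[of n v w]
      by (simp add: algebra_simps power2_eq_square)
    also have "inner_n n d d \<le> M"
    proof -
      have "inner_n n d d + inner_n n e e = 2 * inner_n n v v + 2 * inner_n n w w"
        unfolding d_def e_def inner_n_lincomb inner_n_lincomb_right inner_n_commute[of n v w] by simp
      moreover have "inner_n n w w \<le> \<rho> + 1" using w(2) \<eta>(2) by linarith
      moreover have "0 \<le> inner_n n e e" by (rule inner_n_nonneg)
      ultimately show ?thesis using v(2) unfolding M_def distrib_left by linarith
    qed
    finally have "0 \<le> \<eta> + 2 * t * (inner_n n w v - inner_n n w w) + t\<^sup>2 * M"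
      using w(2) by (simp add: mult_left_mono)
    also have "t\<^sup>2 * M = t * (a / 2)" using t(3) by (simp add: power2_eq_square mult.assoc)
    also have "\<eta> \<le> t * (a / 2)" using \<eta>(3) by simp
    finally have "0 \<le> t * (2 * (inner_n n w v - inner_n n w w) + a)" by (simp add: algebra_simps)
    hence "0 \<le> 2 * (inner_n n w v - inner_n n w w) + a" using t(1) by (simp add: zero_le_mult_iff)
    thus ?thesis using wr \<rho> unfolding right_diff_distrib by linarith
  qed
  thus ?thesis using w(1) by blast
qed

text \<open>Differences of data points have length at most 2 R but margin at least 2. This excludes
  degenerate \<open>R\<close> and \<open>w0\<close> and later keeps the required defect below
  1.\<close>

lemma separation_radius:
  assumes p: "1 \<le> inner_n n w0 p + b0" and q: "inner_n n w0 q + b0 \<le> -1"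
    and R: "norm_n n p \<le> R" "norm_n n q \<le> R"
  shows "1 \<le> R * norm_n n w0"
proof -
  have "2 \<le> inner_n n w0 p - inner_n n w0 q" using p q by linarith
  also have "\<dots> \<le> norm_n n w0 * norm_n n p + norm_n n w0 * norm_n n q"
    using inner_n_le_norm[of n w0 p] inner_n_le_norm[of n w0 q] by linarith
  also have "\<dots> \<le> norm_n n w0 * R + norm_n n w0 * R"
    using R by (intro add_mono mult_left_mono) (auto simp: L2_set_nonneg)
  finally show ?thesis by (simp add: mult.commute)
qed

text \<open>The near-minimal vector is taken in the convex set of all \<open>w\<close> with \<open>\<langle>w0, w\<rangle> \<ge> 2\<close> whose inner
  products with differences of data points are almost preserved. This set contains the convex hull
  of these differences, so no convex combinations of data points have to be handled.\<close>

lemma rip_separation: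
  assumes rip: "rip m n A (2 * s) L" "0 \<le> L" "4 * L * (R * norm_n n w0)\<^sup>2 \<le> 1"
    and P: "P \<noteq> {}" "\<And>x. x \<in> P \<Longrightarrow> 1 \<le> inner_n n w0 x + b0"
    and N: "N \<noteq> {}" "\<And>x. x \<in> N \<Longrightarrow> inner_n n w0 x + b0 \<le> -1"
    and bd: "\<And>x. x \<in> P \<union> N \<Longrightarrow> norm_n n x \<le> R \<and> norm0 n x \<le> s"
  obtains w b where "w \<in> space (Rn m)"
    "\<And>x. x \<in> P \<Longrightarrow> 1 \<le> inner_n m w (mat_vec m n A x) + b"
    "\<And>x. x \<in> N \<Longrightarrow> inner_n m w (mat_vec m n A x) + b \<le> -1"
proof -
  let ?B = "gram_defect m n A"
  obtain p0 q0 where p0: "p0 \<in> P" and q0: "q0 \<in> N" using P(1) N(1) by blast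
  have Rw: "1 \<le> R * norm_n n w0"
    using separation_radius[OF P(2)[OF p0] N(2)[OF q0]] bd p0 q0 by auto
  have "0 \<le> R" using bd[of p0] p0 L2_set_nonneg[of p0 "{..<n}"] by (meson UnI1 order_trans)
  hence R: "0 < R" using Rw by (cases "R = 0") auto
  have w0: "0 < norm_n n w0" using Rw L2_set_nonneg[of w0 "{..<n}"] by (cases "norm_n n w0 = 0") (auto simp: order_less_le)
  have inR: "inner_n n x x \<le> R\<^sup>2" if "x \<in> P \<union> N" for x
    using bd[OF that] L2_set_nonneg[of x "{..<n}"] unfolding norm_n_sq[symmetric] by (intro power_mono) auto
  define E where "E = L * R * R"
  have Bxy: "\<bar>?B x y\<bar> \<le> E" if x: "x \<in> P \<union> N" and y: "y \<in> P \<union> N" for x y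
    unfolding E_def
  proof (rule rip_bilinear[OF rip(1,2), of "{i. i < n \<and> x i \<noteq> 0} \<union> {i. i < n \<and> y i \<noteq> 0}"])
    show "card ({i. i < n \<and> x i \<noteq> 0} \<union> {i. i < n \<and> y i \<noteq> 0}) \<le> 2 * s"
      using card_Un_le[of "{i. i < n \<and> x i \<noteq> 0}" "{i. i < n \<and> y i \<noteq> 0}"] bd[OF x] bd[OF y]
      unfolding norm0_def by linarith
  qed (use R inR[OF x] inR[OF y] in auto)
  define D where "D = (\<lambda>x y (i::nat). 1 * x i + (-1) * (y i :: real) :: real)"
  define K where "K = {w. (\<forall>x\<in>P. \<forall>y\<in>N. \<bar>?B w (D x y)\<bar> \<le> 4 * E) \<and> 2 \<le> inner_n n w0 w}"
  define a where "a = 4 / (norm_n n w0)\<^sup>2"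
  have a0: "0 < a" using w0 by (simp add: a_def)
  have aK: "a \<le> inner_n n w w" if "w \<in> K" for w
  proof -
    have "2 \<le> norm_n n w0 * norm_n n w" using that inner_n_le_norm[of n w0 w] unfolding K_def by auto
    hence "2\<^sup>2 \<le> (norm_n n w0 * norm_n n w)\<^sup>2" by (intro power_mono) auto
    thus ?thesis using w0 unfolding a_def norm_n_sq[symmetric] by (simp add: power_mult_distrib field_simps)
  qed
  have DK: "D x y \<in> K" if x: "x \<in> P" and y: "y \<in> N" for x y
  proof -
    have "\<bar>?B (D x y) (D u v)\<bar> \<le> 4 * E" if u: "u \<in> P" and v: "v \<in> N" for u v
    proof -
      have "?B (D x y) (D u v) = ?B x u - ?B x v - ?B y u + ?B y v"
        unfolding D_def gram_defect_lincomb gram_defect_lincomb_right by simp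
      moreover have "\<bar>?B x u\<bar> \<le> E" "\<bar>?B x v\<bar> \<le> E" "\<bar>?B y u\<bar> \<le> E" "\<bar>?B y v\<bar> \<le> E"
        using x y u v by (auto intro: Bxy)
      ultimately show ?thesis by linarith
    qed
    moreover have "2 \<le> inner_n n w0 (D x y)"
      unfolding D_def inner_n_lincomb_right using P(2)[OF x] N(2)[OF y] by simp
    ultimately show ?thesis unfolding K_def by blast
  qed
  have conv: "(\<lambda>i. (1 - t) * u i + t * v i) \<in> K" if u: "u \<in> K" and v: "v \<in> K" and t: "0 \<le> t" "t \<le> 1" for u v t
  proof -
    have "\<bar>(1 - t) * ?B u (D x y) + t * ?B v (D x y)\<bar> \<le> 4 * E" if "x \<in> P" "y \<in> N" for x y
    proof -
      have "\<bar>(1 - t) * ?B u (D x y) + t * ?B v (D x y)\<bar> \<le> (1 - t) * \<bar>?B u (D x y)\<bar> + t * \<bar>?B v (D x y)\<bar>"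
        using t by (intro order_trans[OF abs_triangle_ineq]) (simp add: abs_mult)
      also have "\<dots> \<le> (1 - t) * (4 * E) + t * (4 * E)"
        using u v that t unfolding K_def by (intro add_mono mult_left_mono) auto
      also have "\<dots> = 4 * E" by (simp add: algebra_simps)
      finally show ?thesis .
    qed
    moreover have "2 \<le> (1 - t) * inner_n n w0 u + t * inner_n n w0 v"
    proof -
      have "(1 - t) * 2 + t * 2 \<le> (1 - t) * inner_n n w0 u + t * inner_n n w0 v"
        using u v t unfolding K_def by (intro add_mono mult_left_mono) auto
      thus ?thesis by simp
    qed
    ultimately show ?thesis
      unfolding K_def gram_defect_lincomb inner_n_lincomb_right mem_Collect_eq by blast
  qed
  \<comment> \<open>The bound 4 R^2 admits every \<open>D x y\<close>, and the inequality is applied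
    only to these.\<close>
  have "\<exists>w\<in>K. \<forall>v\<in>K. inner_n n v v \<le> 4 * R\<^sup>2 \<longrightarrow> a / 2 \<le> inner_n n w v"
  proof (rule near_minimal_norm[OF conv _ a0 aK])
    show "K \<noteq> {}" using DK p0 q0 by blast
    show "0 \<le> 4 * R\<^sup>2" by simp
  qed
  then obtain w where w: "w \<in> K"
    and wv: "\<And>v. v \<in> K \<Longrightarrow> inner_n n v v \<le> 4 * R\<^sup>2 \<Longrightarrow> a / 2 \<le> inner_n n w v" by blast
  define f where "f = (\<lambda>x. inner_n m (mat_vec m n A w) (mat_vec m n A x))"
  \<comment> \<open>The gap a / 2 = 2 \<gamma> before compression loses at most 4 E \<le> \<gamma>,
    so \<gamma> remains.\<close>
  define \<gamma> where "\<gamma> = 1 / (norm_n n w0)\<^sup>2"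
  have \<gamma>: "0 < \<gamma>" using w0 by (simp add: \<gamma>_def)
  have gap: "\<gamma> \<le> f x - f y" if x: "x \<in> P" and y: "y \<in> N" for x y
  proof -
    have "inner_n n (D x y) (D x y) \<le> 4 * R\<^sup>2"
    proof -
      have "inner_n n (D x y) (D x y) = inner_n n x x - 2 * inner_n n x y + inner_n n y y"
        unfolding D_def inner_n_lincomb inner_n_lincomb_right inner_n_commute[of n y x] by simp
      moreover have "\<bar>inner_n n x y\<bar> \<le> R * R" using inR[of x] inR[of y] x y R by (intro inner_n_le_mult) auto
      ultimately show ?thesis using inR[of x] inR[of y] x y by (simp add: power2_eq_square abs_le_iff)
    qed
    hence "a / 2 \<le> inner_n n w (D x y)" using wv DK x y by blast
    moreover have "\<bar>?B w (D x y)\<bar> \<le> 4 * E" using w x y unfolding K_def by blast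
    moreover have "4 * E \<le> \<gamma>"
      using rip(3) w0 unfolding \<gamma>_def E_def by (simp add: field_simps power2_eq_square)
    moreover have "f x - f y = ?B w (D x y) + inner_n n w (D x y)"
      unfolding D_def gram_defect_lincomb_right inner_n_lincomb_right f_def
      by (simp add: gram_defect_def)
    moreover have "a / 2 = 2 * \<gamma>" by (simp add: a_def \<gamma>_def)
    ultimately show ?thesis by linarith
  qed
  define c where "c = Inf (f ` P)"
  have bddf: "bdd_below (f ` P)" using gap[OF _ q0] \<gamma> by (intro bdd_belowI2[of _ "f q0"]) force
  have cP: "c \<le> f x" if "x \<in> P" for x unfolding c_def using bddf that by (intro cINF_lower)
  have cN: "f y \<le> c - \<gamma>" if "y \<in> N" for y
  proof -
    have "f y + \<gamma> \<le> c" unfolding c_def using gap[OF _ that] P(1) by (intro cINF_greatest) (auto simp: algebra_simps)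
    thus ?thesis by simp
  qed
  \<comment> \<open>Scaling by 2 / \<gamma> with bias 1 - 2 c / \<gamma> is the affine map that
    sends c to 1 and c - \<gamma> to -1.\<close>
  define w' where "w' = (\<lambda>i\<in>{..<m}. 2 / \<gamma> * mat_vec m n A w i)"
  have w'f: "inner_n m w' (mat_vec m n A x) = 2 / \<gamma> * f x" for x
    unfolding w'_def f_def inner_n_def by (simp add: sum_distrib_left mult.assoc)
  show ?thesis
  proof (rule that)
    show "w' \<in> space (Rn m)" by (auto simp: w'_def space_PiM)
    show "1 \<le> inner_n m w' (mat_vec m n A x) + (1 - 2 / \<gamma> * c)" if "x \<in> P" for x
      using cP[OF that] \<gamma> unfolding w'f by (simp add: field_simps)
    show "inner_n m w' (mat_vec m n A x) + (1 - 2 / \<gamma> * c) \<le> -1" if "x \<in> N" for x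
      using cN[OF that] \<gamma> unfolding w'f by (simp add: field_simps)
  qed
qed

section \<open>Measurability of separability\<close>

lemma inner_mat_vec_eq_sum: "inner_n m w (mat_vec m n A x) = (\<Sum>i<m. w i * (\<Sum>j<n. A i j * x j))"
  by (simp add: inner_n_def mat_vec_def)

lemma inner_mat_vec_measurable: "(\<lambda>x. inner_n m w (mat_vec m n A x)) \<in> borel_measurable (Rn n)"
  unfolding inner_mat_vec_eq_sum by measurable

lemma rational_approx:
  assumes "0 < \<eta>"
  obtains q :: real where "q \<in> \<rat>" "\<bar>q - r\<bar> \<le> \<eta>"
proof -
  obtain q where "q \<in> \<rat>" "r - \<eta> < q" "q < r + \<eta>"
    using Rats_dense_in_real[of "r - \<eta>" "r + \<eta>"] assms by auto
  thus ?thesis using that[of q] by (simp add: abs_le_iff)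
qed

text \<open>Relaxing the margin to \<open>1/2\<close> makes room for a perturbation of the separating hyperplane, so
  that countably many hyperplanes suffice. This makes separability a measurable event.\<close>

lemma separable_under_iff_rational:
  assumes \<mu>: "prob_space \<mu>" "sets \<mu> = sets (Rn_labelled n)"
    and bd: "AE p in \<mu>. norm_n n (fst p) \<le> R"
  shows "separable_under m n \<mu> A \<longleftrightarrow> (\<exists>w\<in>{..<m} \<rightarrow>\<^sub>E \<rat>. \<exists>b\<in>\<rat>.
      measure \<mu> {(x, y) \<in> space \<mu>. y * (inner_n m w (mat_vec m n A x) + b) \<ge> 1 / 2} = 1)"
    (is "_ \<longleftrightarrow> ?rat")
proof
  note iff = prob_margin_iff[OF \<mu> inner_mat_vec_measurable]
  assume "separable_under m n \<mu> A"
  then obtain w b where w: "AE p in \<mu>. snd p * (inner_n m w (mat_vec m n A (fst p)) + b) \<ge> 1"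
    unfolding separable_under_def iff by blast
  \<comment> \<open>If every entry of \<open>w\<close> and the bias change by at most \<eta>, the
    decision value changes by at most \<eta> K: the summand 1 stands for the bias, the rest for
    \<open>w\<close>. The choice of \<eta> spends exactly the allowed 1/2.\<close>
  define K where "K = (\<Sum>i<m. norm_n n (A i)) * \<bar>R\<bar> + 1"
  have K: "K > 0" unfolding K_def by (intro add_nonneg_pos mult_nonneg_nonneg sum_nonneg) (auto simp: L2_set_nonneg)
  define \<eta> where "\<eta> = 1 / (2 * K)"
  have \<eta>: "\<eta> > 0" "\<eta> * K = 1 / 2" using K by (auto simp: \<eta>_def)
  have "\<forall>i. \<exists>q. q \<in> \<rat> \<and> \<bar>q - w i\<bar> \<le> \<eta>" using rational_approx[OF \<eta>(1)] by metis
  then obtain q where q: "\<And>i. q i \<in> \<rat>" "\<And>i. \<bar>q i - w i\<bar> \<le> \<eta>" by metis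
  obtain c where c: "c \<in> \<rat>" "\<bar>c - b\<bar> \<le> \<eta>" using rational_approx[OF \<eta>(1)] .
  define q' where "q' = restrict q {..<m}"
  have q': "q' \<in> {..<m} \<rightarrow>\<^sub>E \<rat>" using q(1) by (auto simp: q'_def)
  have close: "\<bar>(inner_n m q' (mat_vec m n A x) + c) - (inner_n m w (mat_vec m n A x) + b)\<bar> \<le> 1 / 2"
    if x: "norm_n n x \<le> R" for x
  proof -
    have "\<bar>inner_n m q' (mat_vec m n A x) - inner_n m w (mat_vec m n A x)\<bar>
        = \<bar>\<Sum>i<m. (q i - w i) * inner_n n (A i) x\<bar>"
      unfolding inner_n_def[of m] mat_vec_def q'_def
      by (simp add: sum_subtractf[symmetric] left_diff_distrib)
    also have "\<dots> \<le> (\<Sum>i<m. \<eta> * (norm_n n (A i) * \<bar>R\<bar>))"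
    proof (rule order_trans[OF sum_abs], rule sum_mono)
      fix i
      have "\<bar>inner_n n (A i) x\<bar> \<le> norm_n n (A i) * norm_n n x" by (rule inner_n_le_norm)
      also have "\<dots> \<le> norm_n n (A i) * \<bar>R\<bar>" using x by (intro mult_left_mono) (auto simp: L2_set_nonneg)
      finally have "\<bar>inner_n n (A i) x\<bar> \<le> norm_n n (A i) * \<bar>R\<bar>" .
      thus "\<bar>(q i - w i) * inner_n n (A i) x\<bar> \<le> \<eta> * (norm_n n (A i) * \<bar>R\<bar>)"
        unfolding abs_mult using q(2) \<eta> by (intro mult_mono) auto
    qed
    also have "\<dots> = \<eta> * (K - 1)" by (simp add: K_def sum_distrib_left sum_distrib_right mult.assoc)
    finally show ?thesis using c(2) \<eta>(2) unfolding right_diff_distrib by linarith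
  qed
  have "AE p in \<mu>. snd p * (inner_n m q' (mat_vec m n A (fst p)) + c) \<ge> 1 / 2"
    using w bd AE_space[of \<mu>]
  proof eventually_elim
    fix p
    assume p: "1 \<le> snd p * (inner_n m w (mat_vec m n A (fst p)) + b)" "norm_n n (fst p) \<le> R" "p \<in> space \<mu>"
    have "snd p = -1 \<or> snd p = 1" using p(3) unfolding space_labelled[OF \<mu>] by auto
    thus "1 / 2 \<le> snd p * (inner_n m q' (mat_vec m n A (fst p)) + c)"
    proof
      assume y: "snd p = -1"
      show ?thesis using p(1) close[OF p(2)] unfolding y mult_minus1 by linarith
    next
      assume y: "snd p = 1"
      show ?thesis using p(1) close[OF p(2)] unfolding y mult_1 by linarith
    qed
  qed
  thus ?rat unfolding iff using q' c(1) by blast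
next
  note iff = prob_margin_iff[OF \<mu> inner_mat_vec_measurable]
  assume ?rat
  then obtain q c where q: "AE p in \<mu>. snd p * (inner_n m q (mat_vec m n A (fst p)) + c) \<ge> 1 / 2"
    unfolding iff by blast
  define w where "w = (\<lambda>i\<in>{..<m}. 2 * q i)"
  have w: "inner_n m w v = 2 * inner_n m q v" for v
    unfolding inner_n_def w_def by (simp add: sum_distrib_left mult.assoc)
  have "AE p in \<mu>. snd p * (inner_n m w (mat_vec m n A (fst p)) + 2 * c) \<ge> 1"
    using q unfolding w by eventually_elim (simp add: algebra_simps)
  moreover have "w \<in> space (Rn m)" by (auto simp: w_def space_PiM)
  ultimately show "separable_under m n \<mu> A" unfolding separable_under_def iff by blast
qed

text \<open>For a fixed hyperplane the margin is jointly measurable in the matrix and the data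
  point, so the \<mu>-measure of its sections is measurable in the matrix. The rational criterion
  then leaves a countable union.\<close>

lemma separable_under_sets:
  assumes \<mu>: "prob_space \<mu>" "sets \<mu> = sets (Rn_labelled n)"
    and bd: "AE p in \<mu>. norm_n n (fst p) \<le> R"
    and M: "sets M = sets (Pi\<^sub>M {..<m} (\<lambda>_. Rn n))"
  shows "{Q \<in> space M. separable_under m n \<mu> (scaled m Q)} \<in> sets M"
proof -
  interpret prob_space \<mu> by (rule \<mu>)
  define E where "E = (\<lambda>w b Q. {(x, y) \<in> space \<mu>. y * (inner_n m w (mat_vec m n (scaled m Q) x) + b) \<ge> 1 / 2})"
  have E: "{Q \<in> space M. measure \<mu> (E w b Q) = 1} \<in> sets M" for w b
  proof -
    let ?f = "\<lambda>(Q, p). snd p * (inner_n m w (mat_vec m n (scaled m Q) (fst p)) + b)"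
    have Qm: "(\<lambda>z. fst z i j) \<in> borel_measurable (M \<Otimes>\<^sub>M \<mu>)" if "i < m" "j < n" for i j
    proof -
      have "(\<lambda>Q. Q i) \<in> measurable (Pi\<^sub>M {..<m} (\<lambda>_. Rn n)) (Rn n)"
        using that by (intro measurable_component_singleton) simp
      moreover have "(\<lambda>q. q j) \<in> measurable (Rn n) borel"
        using that by (intro measurable_component_singleton) simp
      ultimately have "(\<lambda>Q. Q i j) \<in> measurable (Pi\<^sub>M {..<m} (\<lambda>_. Rn n)) borel"
        by (rule measurable_compose)
      hence "(\<lambda>Q. Q i j) \<in> borel_measurable M" using measurable_cong_sets[OF M refl] by blast
      thus ?thesis by (rule measurable_compose[OF measurable_fst])
    qed
    have xm: "(\<lambda>z. fst (snd z) j) \<in> borel_measurable (M \<Otimes>\<^sub>M \<mu>)" if "j < n" for j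
    proof -
      have "(\<lambda>x. x j) \<in> borel_measurable (Rn n)" using that by (intro measurable_component_singleton) simp
      hence "(\<lambda>p. fst p j) \<in> borel_measurable (Rn_labelled n)" by (rule measurable_compose[OF measurable_fst])
      hence "(\<lambda>p. fst p j) \<in> borel_measurable \<mu>" using measurable_cong_sets[OF \<mu>(2) refl] by blast
      thus ?thesis by (rule measurable_compose[OF measurable_snd])
    qed
    have "(\<lambda>p. snd p) \<in> borel_measurable (Rn_labelled n)"
      by (rule measurable_compose[OF measurable_snd borel_measurable_count_space])
    hence "(\<lambda>p. snd p) \<in> borel_measurable \<mu>" using measurable_cong_sets[OF \<mu>(2) refl] by blast
    hence ym: "(\<lambda>z. snd (snd z)) \<in> borel_measurable (M \<Otimes>\<^sub>M \<mu>)" by (rule measurable_compose[OF measurable_snd])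
    have [measurable]: "?f \<in> borel_measurable (M \<Otimes>\<^sub>M \<mu>)"
      unfolding inner_mat_vec_eq_sum case_prod_beta
      by (intro borel_measurable_times borel_measurable_add borel_measurable_sum borel_measurable_const
          Qm xm ym) auto
    define G where "G = {z \<in> space (M \<Otimes>\<^sub>M \<mu>). ?f z \<ge> 1 / 2}"
    have "G \<in> sets (M \<Otimes>\<^sub>M \<mu>)" unfolding G_def by measurable
    hence em: "(\<lambda>Q. emeasure \<mu> (Pair Q -` G)) \<in> borel_measurable M"
      by (rule measurable_emeasure_Pair)
    have "Pair Q -` G = E w b Q" if "Q \<in> space M" for Q
      using that unfolding G_def E_def by (auto simp: space_pair_measure)
    hence "{Q \<in> space M. measure \<mu> (E w b Q) = 1} = {Q \<in> space M. emeasure \<mu> (Pair Q -` G) = 1}"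
      by (auto simp: emeasure_eq_measure)
    also have "\<dots> \<in> sets M" using em by measurable
    finally show ?thesis .
  qed
  have "{Q \<in> space M. separable_under m n \<mu> (scaled m Q)}
      = (\<Union>w\<in>{..<m} \<rightarrow>\<^sub>E \<rat>. \<Union>b\<in>\<rat>. {Q \<in> space M. measure \<mu> (E w b Q) = 1})"
    unfolding separable_under_iff_rational[OF \<mu> bd] E_def by blast
  also have "\<dots> \<in> sets M"
    by (intro sets.countable_UN'' countable_PiE countable_rat E) auto
  finally show ?thesis .
qed

section \<open>From separated supports to the probability bound\<close>

lemma separable_under_of_supports:
  assumes \<mu>: "prob_space \<mu>" "sets \<mu> = sets (Rn_labelled n)"
    and w: "w \<in> space (Rn m)"
    and pos: "\<And>x. x \<in> label_support n \<mu> 1 \<Longrightarrow> 1 \<le> inner_n m w (mat_vec m n A x) + b"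
    and neg: "\<And>x. x \<in> label_support n \<mu> (-1) \<Longrightarrow> inner_n m w (mat_vec m n A x) + b \<le> -1"
  shows "separable_under m n \<mu> A"
proof -
  have "AE p in \<mu>. snd p * (inner_n m w (mat_vec m n A (fst p)) + b) \<ge> 1"
    using AE_label_support[OF \<mu>] AE_space[of \<mu>]
  proof eventually_elim
    fix p assume p: "fst p \<in> label_support n \<mu> (snd p)" "p \<in> space \<mu>"
    have "snd p = -1 \<or> snd p = 1" using p(2) unfolding space_labelled[OF \<mu>] by auto
    thus "1 \<le> snd p * (inner_n m w (mat_vec m n A (fst p)) + b)"
    proof
      assume y: "snd p = -1"
      show ?thesis using neg[of "fst p"] p(1) unfolding y by simp
    next
      assume y: "snd p = 1"
      show ?thesis using pos[of "fst p"] p(1) unfolding y by simp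
    qed
  qed
  thus ?thesis unfolding separable_under_def prob_margin_iff[OF \<mu> inner_mat_vec_measurable]
    using w by blast
qed

theorem theorem3:
  fixes \<kappa> :: real
  assumes "\<kappa> > 0"
  shows "\<exists>C>0. \<forall>(n::nat) (s::nat) (m::nat) (\<mu> :: ((nat \<Rightarrow> real) \<times> real) measure)
            (w0 :: nat \<Rightarrow> real) (b0 :: real) (R :: real)
            (M :: (nat \<Rightarrow> nat \<Rightarrow> real) measure) (\<epsilon> :: real).
           1 \<le> s \<and> s \<le> n \<and>
           prob_space \<mu> \<and> sets \<mu> = sets (Rn_labelled n) \<and>
           w0 \<in> space (Rn n) \<and> separable_by n \<mu> w0 b0 \<and>
           (\<forall>x\<in>data_support n \<mu>. norm_n n x \<le> R \<and> norm0 n x \<le> s) \<and>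
           subgaussian_matrix_law m n \<kappa> M \<and>
           0 < \<epsilon> \<and> \<epsilon> < 1 \<and>
           real m > C * R ^ 4 * norm_n n w0 ^ 4 *
             (2 * real s * ln (exp 1 * real n / (2 * real s)) + ln (2 * inverse \<epsilon>))
           \<longrightarrow> measure M {Q \<in> space M. separable_under m n \<mu> (\<lambda>i j. 1 / sqrt (real m) * Q i j)}
                 \<ge> 1 - \<epsilon>"
proof -
  \<comment> \<open>This is 64 * 31232 e \<kappa>^4; the 64 comes from 1 / \<delta>^2 = 64 r^4 for
    the defect chosen below.\<close>
  define C where "C = 1998848 * exp 1 * \<kappa> ^ 4"
  have C: "C > 0" using assms by (simp add: C_def)
  show ?thesis
  proof (intro exI[of _ C] conjI C allI impI)
    fix n s m :: nat and \<mu> :: "((nat \<Rightarrow> real) \<times> real) measure" and w0 b0 R M \<epsilon>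
    let ?F = "2 * real s * ln (exp 1 * real n / (2 * real s)) + ln (2 * inverse \<epsilon>)"
    assume "1 \<le> s \<and> s \<le> n \<and> prob_space \<mu> \<and> sets \<mu> = sets (Rn_labelled n) \<and>
           w0 \<in> space (Rn n) \<and> separable_by n \<mu> w0 b0 \<and>
           (\<forall>x\<in>data_support n \<mu>. norm_n n x \<le> R \<and> norm0 n x \<le> s) \<and>
           subgaussian_matrix_law m n \<kappa> M \<and> 0 < \<epsilon> \<and> \<epsilon> < 1 \<and>
           real m > C * R ^ 4 * norm_n n w0 ^ 4 * ?F"
    hence s: "1 \<le> s" "s \<le> n" and \<mu>: "prob_space \<mu>" "sets \<mu> = sets (Rn_labelled n)"
      and sep: "separable_by n \<mu> w0 b0"
      and supp: "\<And>x. x \<in> data_support n \<mu> \<Longrightarrow> norm_n n x \<le> R \<and> norm0 n x \<le> s"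
      and law: "subgaussian_matrix_law m n \<kappa> M" and \<epsilon>: "0 < \<epsilon>" "\<epsilon> < 1"
      and large: "real m > C * R ^ 4 * norm_n n w0 ^ 4 * ?F"
      by blast+
    interpret M: prob_space M using law by (simp add: subgaussian_matrix_law_def)
    define P where "P = label_support n \<mu> 1"
    define N where "N = label_support n \<mu> (-1)"
    have bd: "norm_n n x \<le> R \<and> norm0 n x \<le> s" if "x \<in> P \<union> N" for x
      using supp that by (simp add: data_support_def P_def N_def)
    have posP: "1 \<le> inner_n n w0 x + b0" if "x \<in> P" for x
      using label_support_margin[OF \<mu> sep, of x 1] that by (simp add: P_def)
    have negN: "inner_n n w0 x + b0 \<le> -1" if "x \<in> N" for x
      using label_support_margin[OF \<mu> sep, of x "-1"] that by (simp add: N_def)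
    let ?S = "{Q \<in> space M. separable_under m n \<mu> (scaled m Q)}"
    have "AE p in \<mu>. norm_n n (fst p) \<le> R"
      using AE_label_support[OF \<mu>] AE_space[of \<mu>]
    proof eventually_elim
      fix p assume p: "fst p \<in> label_support n \<mu> (snd p)" "p \<in> space \<mu>"
      have "snd p = -1 \<or> snd p = 1" using p(2) unfolding space_labelled[OF \<mu>] by auto
      hence "fst p \<in> P \<union> N" using p(1) by (auto simp: P_def N_def)
      thus "norm_n n (fst p) \<le> R" using bd by blast
    qed
    hence S: "?S \<in> sets M"
      using law by (intro separable_under_sets[OF \<mu>]) (auto simp: subgaussian_matrix_law_def)
    show "measure M ?S \<ge> 1 - \<epsilon>"
    \<comment> \<open>With a single class, r \<ge> 1 may fail, but the zero vector with bias 1 or -1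
      separates for every matrix.\<close>
    proof (cases "P = {} \<or> N = {}")
      case True
      define w where "w = (\<lambda>i\<in>{..<m}. 0 :: real)"
      have w: "w \<in> space (Rn m)" "\<And>v. inner_n m w v = 0"
        by (auto simp: w_def space_PiM inner_n_def)
      have "separable_under m n \<mu> A" for A
      proof (cases "P = {}")
        case True
        show ?thesis
          using True by (intro separable_under_of_supports[OF \<mu> w(1), of _ "-1"]) (auto simp: w(2) P_def)
      next
        case False
        hence "N = {}" using \<open>P = {} \<or> N = {}\<close> by blast
        thus ?thesis
          by (intro separable_under_of_supports[OF \<mu> w(1), of _ 1]) (auto simp: w(2) N_def)
      qed
      thus ?thesis using \<epsilon> by (simp add: M.prob_space)
    next
      case False
      hence ne: "P \<noteq> {}" "N \<noteq> {}" by auto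
      then obtain p q where pq: "p \<in> P" "q \<in> N" by blast
      define r where "r = R * norm_n n w0"
      have r: "1 \<le> r" unfolding r_def
        using separation_radius[OF posP[OF pq(1)] negN[OF pq(2)]] bd pq by auto
      \<comment> \<open>The isometry constant is 2 \<delta>, and 4 (2 \<delta>) r^2 = 1 is the
        largest defect that \<open>rip_separation\<close> admits.\<close>
      define \<delta> where "\<delta> = 1 / (8 * r\<^sup>2)"
      have r2: "1 \<le> r\<^sup>2" using r by simp
      have "1 / (8 * r\<^sup>2) \<le> 1 / 1" using r2 by (intro divide_left_mono) auto
      hence \<delta>: "0 < \<delta>" "\<delta> \<le> 1" using r by (auto simp: \<delta>_def)
      have \<delta>2: "64 * r ^ 4 * \<delta>\<^sup>2 = 1" using r by (simp add: \<delta>_def power_divide power_mult_distrib flip: power_mult)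
      have F: "0 \<le> ?F"
        using card_sparse_grid_exp(1)[OF s] \<epsilon> by (intro add_nonneg_nonneg ln_ge_zero) (auto simp: field_simps)
      have large': "C * r ^ 4 * ?F < real m"
        using large by (simp add: r_def power_mult_distrib mult.assoc)
      have "0 \<le> C * r ^ 4 * ?F" using C F by (intro mult_nonneg_nonneg) auto
      hence m: "0 < m" using large' by linarith
      have "C * r ^ 4 * ?F * \<delta>\<^sup>2 = 31232 * exp 1 * \<kappa> ^ 4 * ?F * (64 * r ^ 4 * \<delta>\<^sup>2)"
        by (simp add: C_def)
      hence "31232 * exp 1 * \<kappa> ^ 4 * ?F = C * r ^ 4 * ?F * \<delta>\<^sup>2" by (simp only: \<delta>2 mult_1_right)
      also have "\<dots> \<le> real m * \<delta>\<^sup>2" using large' by (intro mult_right_mono) auto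
      finally obtain B where B: "B \<in> sets M" "measure M B \<le> \<epsilon>"
        "\<And>Q. Q \<in> space M - B \<Longrightarrow> rip m n (scaled m Q) (2 * s) (2 * \<delta>)"
        using rip_probability[OF law assms m s \<delta> \<epsilon>] by blast
      have "space M - B \<subseteq> ?S"
      proof
        fix Q assume Q: "Q \<in> space M - B"
        have small: "4 * (2 * \<delta>) * (R * norm_n n w0)\<^sup>2 \<le> 1"
          unfolding r_def[symmetric] using r by (simp add: \<delta>_def)
        obtain w b where w: "w \<in> space (Rn m)"
          "\<And>x. x \<in> P \<Longrightarrow> 1 \<le> inner_n m w (mat_vec m n (scaled m Q) x) + b"
          "\<And>x. x \<in> N \<Longrightarrow> inner_n m w (mat_vec m n (scaled m Q) x) + b \<le> -1"
          using rip_separation[OF B(3)[OF Q] _ small ne(1) posP ne(2) negN bd] \<delta>(1) by auto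
        have "separable_under m n \<mu> (scaled m Q)"
          using separable_under_of_supports[OF \<mu> w(1)] w(2,3) unfolding P_def N_def by blast
        thus "Q \<in> ?S" using Q by blast
      qed
      hence "measure M (space M - B) \<le> measure M ?S" using S by (intro M.finite_measure_mono)
      thus ?thesis using M.prob_compl[OF B(1)] B(2) by linarith
    qed
  qed
qed

end
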